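(* Let $\mathbf e$ be a Brownian excursion and $T_{\mathbf e}$ be the associated Brownian continuum random tree. Then, almost surely, for every $n\in\mathbb N$, $T_{\mathbf e}$ contains infinitely many approximate $n$-stars. In particular, $T_{\mathbf e}$ is almost surely starry.
   Context: **Approximate stars.** Let $A>1$ and $0<\eta<1$ satisfy $A-\eta>1+\eta$ (equivalently $\eta<(A-1)/2$). A metric space $(X,d)$ contains an $(A,\eta)$-approximate $n$-star if there exist $\varrho>0$ and a set of points $\{x_0,\dots,x_n\}\subseteq X$ such that $(A-\eta)\varrho\le d(x_i,x_j)\le A\varrho$ for all $i,j\in\{1,\dots,n\}$ with $i\ne j$, and $\varrho\le d(x_0,x_i)\le(1+\eta)\varrho$ for all $i\in\{1,\dots,n\}$. The set $\{x_0,\dots,x_n\}$ is the star; an approximate $n$-star is an $(A,\eta)$-approximate $n$-star for some such $A,\eta$. **Starry.** $(X,d)$ is starry if there exist $A>1$ and $0<\eta<(A-1)/2$ (independent of $n$) such that for every $n\in\mathbb N$ there is $A_n\ge A$ for which $(X,d)$ contains an $(A_n,\eta)$-approximate $n$-star. **Continuum tree.** An excursion function is a continuous $f\colon[0,1]\to[0,\infty)$ with $f(0)=f(1)=0$ and $f(t)>0$ for $t\in(0,1)$. Its continuum tree is the metric space $T_f=([0,1]/\!\approx_f,d_f)$, where $$d_f(x,y)=f(x)+f(y)-2\min\{f(t):\min\{x,y\}\le t\le\max\{x,y\}\}$$ is a pseudometric on $[0,1]$ and $x\approx_f y$ iff $d_f(x,y)=0$. **Brownian excursion and CRT.** Let $W$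 be a Wiener process on $[0,1]$ and $B(t)=W(t)-tW(1)$ the Brownian bridge; let $t_{\min}$ be the (almost surely unique) point with $B(t_{\min})=\min_{[0,1]}B$. The Brownian excursion is $$\mathbf e(t)=\begin{cases}B(t+t_{\min})-B(t_{\min}),&0\le t\le1-t_{\min},\\ B(t-1+t_{\min})-B(t_{\min}),&1-t_{\min}<t\le1,\end{cases}$$ which is almost surely an excursion function. The Brownian continuum random tree is $(T_{\mathbf e},d_{\mathbf e})$. *)

theory Defs
  imports "HOL-Analysis.Analysis" "HOL-Probability.Probability"
begin

section \<open>Approximate stars\<close>

text \<open>A star is the set \<open>{x\<^sub>0, \<dots>, x\<^sub>n}\<close>. The standing conditions on \<open>A\<close> and \<open>\<eta>\<close>
  are part of the notion.\<close>

context Metric_space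
begin

definition is_approx_star :: "real \<Rightarrow> real \<Rightarrow> nat \<Rightarrow> 'a set \<Rightarrow> bool" where
  "is_approx_star A \<eta> n S \<longleftrightarrow>
     A > 1 \<and> 0 < \<eta> \<and> \<eta> < 1 \<and> A - \<eta> > 1 + \<eta> \<and>
     (\<exists>\<rho>>0. \<exists>x :: nat \<Rightarrow> 'a. S = x ` {0..n} \<and> S \<subseteq> M \<and>
        (\<forall>i\<in>{1..n}. \<forall>j\<in>{1..n}. i \<noteq> j \<longrightarrow> (A - \<eta>) * \<rho> \<le> d (x i) (x j) \<and> d (x i) (x j) \<le> A * \<rho>) \<and>
        (\<forall>i\<in>{1..n}. \<rho> \<le> d (x 0) (x i) \<and> d (x 0) (x i) \<le> (1 + \<eta>) * \<rho>))"

definition contains_approx_star :: "real \<Rightarrow> real \<Rightarrow> nat \<Rightarrow> bool" where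
  "contains_approx_star A \<eta> n \<longleftrightarrow> (\<exists>S. is_approx_star A \<eta> n S)"

definition approx_stars :: "nat \<Rightarrow> 'a set set" where
  "approx_stars n = {S. \<exists>A \<eta>. is_approx_star A \<eta> n S}"

definition starry :: bool where
  "starry \<longleftrightarrow> (\<exists>A \<eta>. A > 1 \<and> 0 < \<eta> \<and> \<eta> < (A - 1) / 2 \<and>
     (\<forall>n. \<exists>A\<^sub>n\<ge>A. contains_approx_star A\<^sub>n \<eta> n))"

end


section \<open>Continuum trees\<close>

definition excursion_function :: "(real \<Rightarrow> real) \<Rightarrow> bool" where
  "excursion_function f \<longleftrightarrow>
     continuous_on {0..1} f \<and> f 0 = 0 \<and> f 1 = 0 \<and> (\<forall>t\<in>{0<..<1}. f t > 0)"

text \<open>The minimum over the interval is written as an infimum; it is attained when \<open>f\<close> is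
  continuous. The definitions below make sense for arbitrary \<open>f\<close>, and the metric space axioms
  hold as soon as \<open>f\<close> is bounded below on \<open>[0,1]\<close>, in particular for excursion functions.\<close>

definition ctree_pdist :: "(real \<Rightarrow> real) \<Rightarrow> real \<Rightarrow> real \<Rightarrow> real" where
  "ctree_pdist f x y = f x + f y - 2 * (INF t\<in>{min x y..max x y}. f t)"

definition ctree_rel :: "(real \<Rightarrow> real) \<Rightarrow> (real \<times> real) set" where
  "ctree_rel f = {(x, y). x \<in> {0..1} \<and> y \<in> {0..1} \<and> ctree_pdist f x y = 0}"

definition ctree :: "(real \<Rightarrow> real) \<Rightarrow> real set set" where
  "ctree f = {0..1} // ctree_rel f"

text \<open>The distance of two classes is that of any representatives. It is set to 0 outside the
  carrier because \<^locale>\<open>Metric_space\<close> demands nonnegativity on the whole type.\<close>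

definition ctree_dist :: "(real \<Rightarrow> real) \<Rightarrow> real set \<Rightarrow> real set \<Rightarrow> real" where
  "ctree_dist f C D =
     (if C \<in> ctree f \<and> D \<in> ctree f
      then ctree_pdist f (SOME x. x \<in> C) (SOME y. y \<in> D) else 0)"

lemma ctree_pdist_commute: "ctree_pdist f x y = ctree_pdist f y x"
  by (simp add: ctree_pdist_def min.commute max.commute)

lemma ctree_pdist_self: "ctree_pdist f x x = 0"
  by (simp add: ctree_pdist_def)

context
  fixes f :: "real \<Rightarrow> real"
  assumes bdd: "bdd_below (f ` {0..1})"
begin

lemma bdd_below_sub: "x \<in> {0..1} \<Longrightarrow> y \<in> {0..1} \<Longrightarrow> bdd_below (f ` {min x y..max x y})"
  by (rule bdd_below_mono[OF bdd]) (intro image_mono, auto)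

lemma INF_le_ctree:
  "x \<in> {0..1} \<Longrightarrow> y \<in> {0..1} \<Longrightarrow> t \<in> {min x y..max x y} \<Longrightarrow> (INF t\<in>{min x y..max x y}. f t) \<le> f t"
  by (intro cINF_lower bdd_below_sub)

lemma ctree_pdist_nonneg:
  assumes "x \<in> {0..1}" "y \<in> {0..1}"
  shows "0 \<le> ctree_pdist f x y"
  using INF_le_ctree[OF assms, of x] INF_le_ctree[OF assms, of y]
  by (simp add: ctree_pdist_def)

lemma ctree_pdist_triangle:
  assumes x: "x \<in> {0..1}" and y: "y \<in> {0..1}" and z: "z \<in> {0..1}"
  shows "ctree_pdist f x z \<le> ctree_pdist f x y + ctree_pdist f y z"
proof -
  let ?m = "\<lambda>x y. (INF t\<in>{min x y..max x y}. f t)"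
  have "min (?m x y) (?m y z) \<le> ?m x z"
  proof (rule cINF_greatest)
    fix t assume t: "t \<in> {min x z..max x z}"
    then have "t \<in> {min x y..max x y} \<or> t \<in> {min y z..max y z}"
      by auto
    then show "min (?m x y) (?m y z) \<le> f t"
      using INF_le_ctree[OF x y, of t] INF_le_ctree[OF y z, of t] by auto
  qed auto
  moreover have "?m x y \<le> f y" "?m y z \<le> f y"
    using INF_le_ctree[OF x y, of y] INF_le_ctree[OF y z, of y] by auto
  ultimately show ?thesis
    by (simp add: ctree_pdist_def min_def split: if_splits)
qed

lemma equiv_ctree_rel: "equiv {0..1} (ctree_rel f)"
proof (rule equivI)
  show "refl_on {0..1} (ctree_rel f)"
    by (auto simp: refl_on_def ctree_rel_def ctree_pdist_self)
  show "sym (ctree_rel f)"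
    by (auto simp: sym_def ctree_rel_def ctree_pdist_commute)
  show "trans (ctree_rel f)"
    unfolding trans_def ctree_rel_def
  proof safe
    fix x y z :: real
    assume xyz: "x \<in> {0..1}" "y \<in> {0..1}" "z \<in> {0..1}"
      and "ctree_pdist f x y = 0" "ctree_pdist f y z = 0"
    then show "ctree_pdist f x z = 0"
      using ctree_pdist_triangle[OF xyz] ctree_pdist_nonneg[OF xyz(1,3)] by linarith
  qed
qed (auto simp: ctree_rel_def)

lemma ctree_dist_class:
  assumes x: "x \<in> {0..1}" and y: "y \<in> {0..1}"
  shows "ctree_dist f (ctree_rel f `` {x}) (ctree_rel f `` {y}) = ctree_pdist f x y"
proof -
  have rep: "(SOME v. v \<in> ctree_rel f `` {u}) \<in> ctree_rel f `` {u}" if "u \<in> {0..1}" for u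
    using equiv_class_self[OF equiv_ctree_rel that] by (rule someI)
  define x' where "x' = (SOME v. v \<in> ctree_rel f `` {x})"
  define y' where "y' = (SOME v. v \<in> ctree_rel f `` {y})"
  have x': "x' \<in> {0..1}" "ctree_pdist f x x' = 0" and y': "y' \<in> {0..1}" "ctree_pdist f y y' = 0"
    using rep[OF x] rep[OF y] by (auto simp: x'_def y'_def ctree_rel_def)
  have "ctree_pdist f x' y' = ctree_pdist f x y"
    using ctree_pdist_triangle[OF x'(1) x y'(1)] ctree_pdist_triangle[OF x y y'(1)]
      ctree_pdist_triangle[OF x x'(1) y] ctree_pdist_triangle[OF x'(1) y'(1) y] x' y'
    by (simp add: ctree_pdist_commute)
  then show ?thesis
    using x y by (simp add: ctree_dist_def x'_def y'_def ctree_def quotientI)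
qed

lemma Metric_space_ctree: "Metric_space (ctree f) (ctree_dist f)"
proof
  have obt: thesis if "C \<in> ctree f" "\<And>x. x \<in> {0..1} \<Longrightarrow> C = ctree_rel f `` {x} \<Longrightarrow> thesis" for C thesis
    using that unfolding ctree_def by (blast elim: quotientE)
  fix C D E
  show "0 \<le> ctree_dist f C D"
  proof (cases "C \<in> ctree f \<and> D \<in> ctree f")
    case True
    then obtain x y where "x \<in> {0..1}" "C = ctree_rel f `` {x}" "y \<in> {0..1}" "D = ctree_rel f `` {y}"
      by (metis obt)
    then show ?thesis by (simp only: ctree_dist_class ctree_pdist_nonneg)
  qed (auto simp: ctree_dist_def)
  show "ctree_dist f C D = ctree_dist f D C"
    by (auto simp: ctree_dist_def ctree_pdist_commute)
  assume C: "C \<in> ctree f" and D: "D \<in> ctree f"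
  obtain x where x: "x \<in> {0..1}" "C = ctree_rel f `` {x}" using obt[OF C] by metis
  obtain y where y: "y \<in> {0..1}" "D = ctree_rel f `` {y}" using obt[OF D] by metis
  show "ctree_dist f C D = 0 \<longleftrightarrow> C = D"
    using x(1) y(1) unfolding x(2) y(2) ctree_dist_class[OF x(1) y(1)]
      eq_equiv_class_iff[OF equiv_ctree_rel x(1) y(1)]
    by (simp add: ctree_rel_def)
  assume E: "E \<in> ctree f"
  obtain z where z: "z \<in> {0..1}" "E = ctree_rel f `` {z}" using obt[OF E] by metis
  show "ctree_dist f C E \<le> ctree_dist f C D + ctree_dist f D E"
    unfolding x(2) y(2) z(2) using x(1) y(1) z(1)
    by (simp only: ctree_dist_class ctree_pdist_triangle)
qed

end

corollary Metric_space_ctree_excursion: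
  assumes "excursion_function f"
  shows "Metric_space (ctree f) (ctree_dist f)"
  using assms
  by (intro Metric_space_ctree bounded_imp_bdd_below compact_imp_bounded compact_continuous_image)
     (auto simp: excursion_function_def)


section \<open>The Brownian excursion\<close>

text \<open>A Wiener process on \<open>[0,1]\<close>. Only the values \<open>W t\<close> for \<open>t \<in> [0,1]\<close> matter; the starting
  point and the continuity of paths are required almost surely.\<close>

locale wiener_process = prob_space M for M :: "'a measure" +
  fixes W :: "real \<Rightarrow> 'a \<Rightarrow> real"
  assumes random_variable_W: "\<And>t. t \<in> {0..1} \<Longrightarrow> random_variable borel (W t)"
    and start: "AE \<omega> in M. W 0 \<omega> = 0"
    and indep_increments:
      "\<And>(n :: nat) (\<tau> :: nat \<Rightarrow> real).
         0 \<le> \<tau> 0 \<Longrightarrow> (\<And>i. i < n \<Longrightarrow> \<tau> i < \<tau> (Suc i)) \<Longrightarrow> \<tau> n \<le> 1 \<Longrightarrow>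
         indep_vars (\<lambda>_. borel) (\<lambda>i \<omega>. W (\<tau> (Suc i)) \<omega> - W (\<tau> i) \<omega>) {..<n}"
    and normal_increments:
      "\<And>s t. 0 \<le> s \<Longrightarrow> s < t \<Longrightarrow> t \<le> 1 \<Longrightarrow>
         distributed M lborel (\<lambda>\<omega>. W t \<omega> - W s \<omega>) (normal_density 0 (sqrt (t - s)))"
    and continuous_paths: "AE \<omega> in M. continuous_on {0..1} (\<lambda>t. W t \<omega>)"

definition bridge :: "(real \<Rightarrow> real) \<Rightarrow> real \<Rightarrow> real" where
  "bridge w t = w t - t * w 1"

text \<open>Cyclic shift of a path at a point where it attains its minimum over \<open>[0,1]\<close>. For the
  Brownian bridge that point is almost surely unique, so the choice made by
  \<^const>\<open>arg_min_on\<close> is immaterial.\<close>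

definition shift_at_min :: "(real \<Rightarrow> real) \<Rightarrow> real \<Rightarrow> real" where
  "shift_at_min b t =
     (let m = arg_min_on b {0..1}
      in if t \<le> 1 - m then b (t + m) - b m
         else b (t - 1 + m) - b m)"

definition brownian_excursion :: "(real \<Rightarrow> 'a \<Rightarrow> real) \<Rightarrow> 'a \<Rightarrow> real \<Rightarrow> real" where
  "brownian_excursion W \<omega> = shift_at_min (bridge (\<lambda>t. W t \<omega>))"

end

theory Submission
  imports Defs
begin

text \<open>A star with \<open>n\<close> tips appears in the tree wherever the coding path oscillates \<open>n\<close> times
  between two levels, up to a small relative error: the tips are the peaks, the centre is a valley.
  It is enough to find such oscillations of the Wiener process \<open>W\<close> in the intervals
  \<open>[1 - 2\<^sup>-\<^sup>k, 1 - 2\<^sup>-\<^sup>k\<^sup>-\<^sup>1]\<close> for infinitely many \<open>k\<close>: on the relevant length scale the drift of the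
  bridge is negligible, and the time of the minimum of the bridge lies outside almost all of these
  intervals, so that the shift carries them to intervals on which the excursion is a vertical
  translate of the bridge. By scaling, the oscillation has the same positive probability for every
  \<open>k\<close>, and the events are independent, so almost surely infinitely many of them occur.

  Positivity is obtained by cutting an interval of length \<open>h\<close> into \<open>R\<^sup>2\<close> blocks and prescribing the
  increment on each block. The prescribed increment has probability of order \<open>1 / R\<close>, whereas by the
  fourth moment bound a deviation of order \<open>sqrt h\<close> within the block has probability of order
  \<open>1 / R\<^sup>4\<close>.\<close>

section \<open>The Wiener process on one block\<close>

lemma (in prob_space) prob_normal_near_ge:
  assumes X: "distributed M lborel X (normal_density 0 \<sigma>)"
    and "0 < \<sigma>" "0 \<le> d" "\<bar>g\<bar> + d \<le> \<sigma>"
  shows "2 * d / (5 * \<sigma>) \<le> prob {\<omega>\<in>space M. \<bar>X \<omega> - g\<bar> \<le> d}"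
proof -
  have [measurable]: "X \<in> borel_measurable M"
    using distributed_measurable[OF X] by simp
  \<comment> \<open>The whole interval lies within one standard deviation of 0, where the density
    has lost at most the factor \<open>exp (1/2)\<close>.\<close>
  have dens: "1 / (5 * \<sigma>) \<le> normal_density 0 \<sigma> x" if "x \<in> {g - d..g + d}" for x
  proof -
    have "x\<^sup>2 \<le> \<sigma>\<^sup>2"
      using that assms by (intro abs_le_square_iff[THEN iffD1]) auto
    then have "exp (- (1/2)) \<le> exp (- x\<^sup>2 / (2 * \<sigma>\<^sup>2))"
      using \<open>0 < \<sigma>\<close> by (simp add: divide_simps)
    moreover have "sqrt (2 * pi * \<sigma>\<^sup>2) * exp (1/2) \<le> 5 * \<sigma>"
    proof (rule power2_le_imp_le)
      have "(sqrt (2 * pi * \<sigma>\<^sup>2) * exp (1/2))\<^sup>2 = 2 * pi * \<sigma>\<^sup>2 * exp 1"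
        by (simp add: power_mult_distrib flip: exp_double)
      \<comment> \<open>The crude bounds 4 for \<open>pi\<close> and 3 for \<open>exp 1\<close>
        suffice, since 2 * 4 * 3 = 24 is below 25.\<close>
      also have "\<dots> \<le> 2 * 4 * \<sigma>\<^sup>2 * 3"
        using pi_less_4 exp_le by (intro mult_mono) auto
      also have "\<dots> \<le> (5 * \<sigma>)\<^sup>2"
        by (simp add: power_mult_distrib)
      finally show "(sqrt (2 * pi * \<sigma>\<^sup>2) * exp (1/2))\<^sup>2 \<le> (5 * \<sigma>)\<^sup>2" .
    qed (use \<open>0 < \<sigma>\<close> in simp)
    then have "1 / (5 * \<sigma>) \<le> 1 / (sqrt (2 * pi * \<sigma>\<^sup>2) * exp (1/2))"
      using \<open>0 < \<sigma>\<close> by (intro divide_left_mono) auto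
    moreover have "1 / (sqrt (2 * pi * \<sigma>\<^sup>2) * exp (1/2)) = 1 / sqrt (2 * pi * \<sigma>\<^sup>2) * exp (- (1/2))"
      by (simp only: exp_minus inverse_eq_divide times_divide_times_eq mult_1)
    ultimately show ?thesis
      unfolding normal_density_def diff_0_right
      using mult_left_mono[of "exp (- (1/2))" "exp (- x\<^sup>2 / (2 * \<sigma>\<^sup>2))" "1 / sqrt (2 * pi * \<sigma>\<^sup>2)"]
      by auto
  qed
  have "ennreal (2 * d / (5 * \<sigma>)) = (\<integral>\<^sup>+x. ennreal (1 / (5 * \<sigma>)) * indicator {g - d..g + d} x \<partial>lborel)"
    using assms by (simp add: nn_integral_cmult_indicator flip: ennreal_mult)
  also have "\<dots> \<le> (\<integral>\<^sup>+x. ennreal (normal_density 0 \<sigma> x) * indicator {g - d..g + d} x \<partial>lborel)"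
    using dens by (intro nn_integral_mono) (auto simp: indicator_def intro!: ennreal_leI simp del: atLeastAtMost_iff)
  also have "\<dots> = emeasure M (X -` {g - d..g + d} \<inter> space M)"
    by (rule distributed_emeasure[OF X, symmetric]) simp
  also have "X -` {g - d..g + d} \<inter> space M = {\<omega>\<in>space M. \<bar>X \<omega> - g\<bar> \<le> d}"
    by auto
  finally show ?thesis
    by (simp add: emeasure_eq_measure)
qed

text \<open>Markov's inequality for the fourth power, whose mean is \<open>3 * \<sigma> ^ 4\<close>.
  The variance would be too weak for chaining: level \<open>m\<close> has \<open>2 ^ m\<close>
  increments, each of variance proportional to \<open>1 / 2 ^ m\<close>.\<close>

lemma (in prob_space) prob_normal_tail_le:
  assumes X: "distributed M lborel X (normal_density 0 \<sigma>)" and "0 < \<sigma>" "0 < c"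
  shows "prob {\<omega>\<in>space M. c \<le> \<bar>X \<omega>\<bar>} \<le> 3 * \<sigma> ^ 4 / c ^ 4"
proof -
  have [measurable]: "X \<in> borel_measurable M"
    using distributed_measurable[OF X] by simp
  have hb: "has_bochner_integral lborel (\<lambda>x. normal_density 0 \<sigma> x * x ^ 4) (3 * \<sigma> ^ 4)"
    using normal_moment_even[OF \<open>0 < \<sigma>\<close>, of 0 2] \<open>0 < \<sigma>\<close>
    by (simp add: fact_numeral power_divide power2_eq_square power4_eq_xxxx field_simps)
  have int: "integrable M (\<lambda>\<omega>. X \<omega> ^ 4)"
    using distributed_integrable[OF X, of "\<lambda>x. x ^ 4"] integrable.intros[OF hb] by simp
  have "(\<integral>\<omega>. X \<omega> ^ 4 \<partial>M) = 3 * \<sigma> ^ 4"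
    using distributed_integral[OF X, of "\<lambda>x. x ^ 4"] has_bochner_integral_integral_eq[OF hb] by simp
  moreover have "{\<omega>\<in>space M. c \<le> \<bar>X \<omega>\<bar>} = {\<omega>\<in>space M. c ^ 4 \<le> X \<omega> ^ 4}"
  proof -
    have "c \<le> \<bar>x\<bar> \<longleftrightarrow> c ^ 4 \<le> x ^ 4" for x :: real
      using power_mono_iff[of c "\<bar>x\<bar>" 4] \<open>0 < c\<close> by (simp add: power_even_abs)
    then show ?thesis by simp
  qed
  ultimately show ?thesis
    using integral_Markov_inequality_measure[OF int sets.empty_sets, of "c ^ 4"] \<open>0 < c\<close> by simp
qed

section \<open>Oscillation of a path along dyadic points\<close>

definition dyadic :: "real \<Rightarrow> real \<Rightarrow> nat \<Rightarrow> nat \<Rightarrow> real" where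
  "dyadic a b m j = a + (b - a) * j / 2 ^ m"

text \<open>The oscillation is controlled at dyadic points only, which keeps the event measurable and
  the level \<open>m\<close> event a function of finitely many increments; for continuous paths this bounds the
  oscillation on the whole interval.\<close>

definition tracks_upto :: "nat \<Rightarrow> (real \<Rightarrow> real) \<Rightarrow> real \<Rightarrow> real \<Rightarrow> real \<Rightarrow> real \<Rightarrow> real \<Rightarrow> bool" where
  "tracks_upto m w a b g d K \<longleftrightarrow>
     \<bar>w b - w a - g\<bar> \<le> d \<and> (\<forall>j\<le>2 ^ m. \<bar>w (dyadic a b m j) - w a\<bar> \<le> K)"

definition tracks :: "(real \<Rightarrow> real) \<Rightarrow> real \<Rightarrow> real \<Rightarrow> real \<Rightarrow> real \<Rightarrow> real \<Rightarrow> bool" where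
  "tracks w a b g d K \<longleftrightarrow> (\<forall>m. tracks_upto m w a b g d K)"

lemma dyadic_0 [simp]: "dyadic a b m 0 = a"
  by (simp add: dyadic_def)

lemma dyadic_double: "dyadic a b (Suc m) (2 * j) = dyadic a b m j"
  by (simp add: dyadic_def)

lemma dyadic_in: "a \<le> b \<Longrightarrow> j \<le> 2 ^ m \<Longrightarrow> dyadic a b m j \<in> {a..b}"
proof -
  assume "a \<le> b" "j \<le> 2 ^ m"
  then have "real j / 2 ^ m \<le> 1"
    by (metis divide_le_eq_1 of_nat_le_iff of_nat_numeral of_nat_power zero_less_numeral zero_less_power)
  then have "(b - a) * (real j / 2 ^ m) \<le> (b - a) * 1"
    using \<open>a \<le> b\<close> by (intro mult_left_mono) auto
  moreover have "0 \<le> (b - a) * (real j / 2 ^ m)"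
    using \<open>a \<le> b\<close> by simp
  ultimately show ?thesis by (simp add: dyadic_def)
qed

lemma tracks_upto_antimono:
  assumes "tracks_upto (Suc m) w a b g d K"
  shows "tracks_upto m w a b g d K"
proof -
  have "\<bar>w (dyadic a b m j) - w a\<bar> \<le> K" if "j \<le> 2 ^ m" for j
    using assms that dyadic_double[of a b m j] unfolding tracks_upto_def
    by (metis mult_le_mono2 power_Suc)
  then show ?thesis
    using assms by (simp add: tracks_upto_def)
qed

text \<open>Chaining: an odd dyadic point of level \<open>m + 1\<close> is one step away from a point of level \<open>m\<close>,
  and the geometric series of the admitted steps sums to \<open>K\<close>.\<close>

lemma dyadic_chaining:
  fixes w :: "real \<Rightarrow> real"
  assumes "0 \<le> K"
    and inc: "\<And>m j. j < 2 ^ m \<Longrightarrow>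
      \<bar>w (dyadic a b m (Suc j)) - w (dyadic a b m j)\<bar> \<le> K / 8 * (7/8) ^ m"
    and "j \<le> 2 ^ m"
  shows "\<bar>w (dyadic a b m j) - w a\<bar> \<le> K"
proof -
  have "\<bar>w (dyadic a b m j) - w a\<bar> \<le> K * (1 - (7/8) ^ Suc m)"
    using \<open>j \<le> 2 ^ m\<close>
  proof (induction m arbitrary: j)
    case 0
    then have "j = 0 \<or> j = 1" by auto
    then show ?case
      using inc[of 0 0] \<open>0 \<le> K\<close> by auto
  next
    case (Suc m)
    have step: "K * (1 - (7/8) ^ Suc m) + K / 8 * (7/8) ^ Suc m = K * (1 - (7/8) ^ Suc (Suc m))"
      by (simp add: algebra_simps)
    show ?case
    proof (cases "even j")
      case True
      then obtain i where i: "j = 2 * i" by blast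
      have "\<bar>w (dyadic a b (Suc m) j) - w a\<bar> \<le> K * (1 - (7/8) ^ Suc m)"
        using Suc.IH[of i] Suc.prems by (simp add: i dyadic_double)
      also have "\<dots> \<le> K * (1 - (7/8) ^ Suc (Suc m))"
        using \<open>0 \<le> K\<close> by (intro mult_left_mono) auto
      finally show ?thesis .
    next
      case False
      then obtain i where i: "j = Suc (2 * i)" by (auto elim: oddE)
      have "i < 2 ^ m" using Suc.prems i by simp
      then show ?thesis
        using Suc.IH[of i] inc[of "2 * i" "Suc m"] step dyadic_double[of a b m i] unfolding i
        by (smt (verit, best) less_imp_le_nat mult_less_mono2 power_Suc zero_less_numeral)
    qed
  qed
  also have "\<dots> \<le> K * 1"
    using \<open>0 \<le> K\<close> by (intro mult_left_mono) auto
  finally show ?thesis by simp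
qed

context wiener_process
begin

lemma measurable_W:
  assumes "t \<in> {0..1}"
  shows "W t \<in> borel_measurable M"
  using random_variable_W[OF assms] .

lemma sets_tracks_upto:
  assumes "0 \<le> a" "a < b" "b \<le> 1"
  shows "{\<omega>\<in>space M. tracks_upto m (\<lambda>t. W t \<omega>) a b g d K} \<in> events"
proof -
  have [measurable]: "W a \<in> borel_measurable M" "W b \<in> borel_measurable M"
    using assms by (auto intro: measurable_W)
  have "W (dyadic a b m j) \<in> borel_measurable M" if "j \<le> 2 ^ m" for j
    using dyadic_in[of a b j m] that assms by (intro measurable_W) auto
  then have "{\<omega>\<in>space M. \<forall>j\<le>2 ^ m. \<bar>W (dyadic a b m j) \<omega> - W a \<omega>\<bar> \<le> K} \<in> events"
    unfolding atMost_iff[symmetric] Ball_def[symmetric]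
    by (intro sets.sets_Collect_finite_All) auto
  moreover have "{\<omega>\<in>space M. \<bar>W b \<omega> - W a \<omega> - g\<bar> \<le> d} \<in> events"
    by measurable
  ultimately show ?thesis
    unfolding tracks_upto_def by (intro sets.sets_Collect_conj)
qed

lemma sets_tracks:
  assumes "0 \<le> a" "a < b" "b \<le> 1"
  shows "{\<omega>\<in>space M. tracks (\<lambda>t. W t \<omega>) a b g d K} \<in> events"
  unfolding tracks_def by (rule sets.sets_Collect_countable_All) (rule sets_tracks_upto[OF assms])

text \<open>The fourth moment bound with variance \<open>(b - a) / 2 ^ m\<close>; here 12288 = 3 *
  8^4 and 1024/2401 is 1/4 divided by (7/8)^4. This ratio is below 1/2, so summing over the
  \<open>2 ^ m\<close> increments of a level still leaves geometric decay.\<close>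

lemma prob_dyadic_increment_le:
  assumes ab: "0 \<le> a" "a < b" "b \<le> 1" and "0 < K" and j: "j < 2 ^ m"
  shows "prob {\<omega>\<in>space M. K / 8 * (7/8) ^ m \<le> \<bar>W (dyadic a b m (Suc j)) \<omega> - W (dyadic a b m j) \<omega>\<bar>}
    \<le> 12288 * (b - a)\<^sup>2 / K ^ 4 * (1024/2401) ^ m"
proof -
  define h where "h = (b - a) / 2 ^ m"
  have "dyadic a b m (Suc j) - dyadic a b m j = h"
    by (simp add: dyadic_def h_def flip: diff_divide_distrib) (simp add: algebra_simps)
  moreover have "0 < h" using ab by (simp add: h_def)
  moreover have "0 \<le> dyadic a b m j" "dyadic a b m (Suc j) \<le> 1"
    using dyadic_in[of a b j m] dyadic_in[of a b "Suc j" m] ab j by auto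
  ultimately have "distributed M lborel (\<lambda>\<omega>. W (dyadic a b m (Suc j)) \<omega> - W (dyadic a b m j) \<omega>)
      (normal_density 0 (sqrt h))"
    using normal_increments[of "dyadic a b m j" "dyadic a b m (Suc j)"] by simp
  from prob_normal_tail_le[OF this, of "K / 8 * (7/8) ^ m"]
  have "prob {\<omega>\<in>space M. K / 8 * (7/8) ^ m \<le> \<bar>W (dyadic a b m (Suc j)) \<omega> - W (dyadic a b m j) \<omega>\<bar>}
      \<le> 3 * sqrt h ^ 4 / (K / 8 * (7/8) ^ m) ^ 4"
    using \<open>0 < h\<close> \<open>0 < K\<close> by simp
  also have "sqrt h ^ 4 = h\<^sup>2"
    using \<open>0 < h\<close> by (simp add: power4_eq_xxxx power2_eq_square)
  also have "3 * h\<^sup>2 / (K / 8 * (7/8) ^ m) ^ 4 = 12288 * (b - a)\<^sup>2 / K ^ 4 * (1 / (2 ^ m)\<^sup>2 / ((7/8) ^ m) ^ 4)"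
    using \<open>0 < K\<close> by (simp add: h_def power_mult_distrib power_divide field_simps)
  also have "1 / (2 ^ m)\<^sup>2 / ((7/8) ^ m) ^ 4 = ((1 / 2\<^sup>2 / (7/8) ^ 4) ^ m :: real)"
    by (simp only: power_divide power_one power_mult[symmetric] mult.commute[of m])
  also have "1 / 2\<^sup>2 / (7/8) ^ 4 = (1024/2401 :: real)"
    by (simp add: power2_eq_square power4_eq_xxxx)
  finally show ?thesis .
qed

text \<open>The total increment is right with at least the first probability. Then tracking can fail
  only if some dyadic increment is too large, and a union bound over all levels and positions gives
  the subtracted term.\<close>

lemma prob_tracks_ge:
  assumes ab: "0 \<le> a" "a < b" "b \<le> 1" and "0 < K" "0 \<le> d" "\<bar>g\<bar> + d \<le> sqrt (b - a)"
  shows "2 * d / (5 * sqrt (b - a)) - 100000 * (b - a)\<^sup>2 / K ^ 4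
    \<le> prob {\<omega>\<in>space M. tracks (\<lambda>t. W t \<omega>) a b g d K}" (is "_ \<le> prob ?T")
proof -
  define c where "c = 12288 * (b - a)\<^sup>2 / K ^ 4"
  define D where "D m j = {\<omega>\<in>space M. K / 8 * (7/8) ^ m \<le>
    \<bar>W (dyadic a b m (Suc j)) \<omega> - W (dyadic a b m j) \<omega>\<bar>}" for m j
  define G where "G = {\<omega>\<in>space M. \<bar>(W b \<omega> - W a \<omega>) - g\<bar> \<le> d}"
  have [measurable]: "W a \<in> borel_measurable M" "W b \<in> borel_measurable M"
    using ab by (auto intro: measurable_W)
  have [measurable]: "D m j \<in> events" if "j < 2 ^ m" for m j
  proof -
    have [measurable]: "W (dyadic a b m j) \<in> borel_measurable M" "W (dyadic a b m (Suc j)) \<in> borel_measurable M"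
      using dyadic_in[of a b j m] dyadic_in[of a b "Suc j" m] that ab by (auto intro!: measurable_W)
    show ?thesis by (simp add: D_def)
  qed
  have [measurable]: "G \<in> events"
    by (simp add: G_def)
  have T: "?T \<in> events"
    by (rule sets_tracks[OF ab])
  let ?U = "\<lambda>m. \<Union>j\<in>{..<2 ^ m}. D m j"
  have U: "prob (?U m) \<le> c * (2048/2401) ^ m" for m
  proof -
    have "prob (?U m) \<le> (\<Sum>j<2 ^ m. prob (D m j))"
      by (intro finite_measure_subadditive_finite) auto
    also have "\<dots> \<le> (\<Sum>j<(2::nat) ^ m. c * (1024/2401) ^ m)"
      using prob_dyadic_increment_le[OF ab \<open>0 < K\<close>]
      by (intro sum_mono) (simp add: D_def c_def)
    also have "\<dots> = c * (2 * (1024/2401)) ^ m"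
      unfolding power_mult_distrib by simp
    also have "2 * (1024/2401) = (2048/2401 :: real)"
      by simp
    finally show ?thesis .
  qed
  have [measurable]: "?U m \<in> events" for m
    by auto
  have summ: "summable (\<lambda>m. c * (2048/2401 :: real) ^ m)"
    by (intro summable_mult summable_geometric) simp
  have summU: "summable (\<lambda>m. prob (?U m))"
    using U by (intro summable_comparison_test'[OF summ, of 0]) auto
  have "prob (\<Union>m. ?U m) \<le> (\<Sum>m. prob (?U m))"
    by (intro finite_measure_subadditive_countably summU) auto
  also have "\<dots> \<le> (\<Sum>m. c * (2048/2401) ^ m)"
    by (intro suminf_le U summU summ)
  \<comment> \<open>Geometric series, with 353 = 2401 - 2048. The resulting constant 12288 * 2401 /
    353 is about 83579 and is rounded up to 100000.\<close>
  also have "\<dots> = c * (2401 / 353)"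
    by (subst suminf_mult) (simp_all add: suminf_geometric)
  also have "\<dots> \<le> 100000 * (b - a)\<^sup>2 / K ^ 4"
    using \<open>0 < K\<close> by (simp add: c_def divide_simps)
  finally have bad: "prob (\<Union>m. ?U m) \<le> 100000 * (b - a)\<^sup>2 / K ^ 4" .
  have "G \<subseteq> ?T \<union> (\<Union>m. ?U m)"
  proof
    fix \<omega> assume "\<omega> \<in> G"
    show "\<omega> \<in> ?T \<union> (\<Union>m. ?U m)"
    proof (cases "\<omega> \<in> (\<Union>m. ?U m)")
      case False
      have "\<bar>W (dyadic a b m j) \<omega> - W a \<omega>\<bar> \<le> K" if "j \<le> 2 ^ m" for m j
        using False \<open>\<omega> \<in> G\<close> \<open>0 < K\<close> that
        by (intro dyadic_chaining[where w = "\<lambda>t. W t \<omega>"]) (auto simp: D_def G_def not_le less_imp_le)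
      then show ?thesis
        using \<open>\<omega> \<in> G\<close> by (simp add: G_def tracks_def tracks_upto_def)
    qed simp
  qed
  then have "prob G \<le> prob ?T + prob (\<Union>m. ?U m)"
    using T finite_measure_mono[of G "?T \<union> (\<Union>m. ?U m)"] measure_Un_le[of ?T M "\<Union>m. ?U m"]
    by (meson order_trans sets.Un sets.countable_nat_UN image_subsetI \<open>\<And>m. ?U m \<in> events\<close>)
  moreover have "2 * d / (5 * sqrt (b - a)) \<le> prob G"
    unfolding G_def using assms by (intro prob_normal_near_ge normal_increments) auto
  ultimately show ?thesis
    using bad by linarith
qed

end

section \<open>Independence of the blocks\<close>

text \<open>Probabilities of finite intersections are products, and a product over a disjoint union
  factors. This passes from single blocks to whole intervals.\<close>

lemma (in prob_space) indep_events_INT_blocks: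
  fixes A :: "'i \<Rightarrow> 'a set" and I :: "'k \<Rightarrow> 'i set"
  assumes A: "indep_events A UNIV" and I: "\<And>k. finite (I k)" "\<And>k. I k \<noteq> {}" "disjoint_family I"
  shows "indep_events (\<lambda>k. \<Inter>i\<in>I k. A i) UNIV"
proof (rule indep_eventsI)
  have ev: "A i \<in> events" for i
    using A by (auto simp: indep_events_def)
  have *: "prob (\<Inter>i\<in>J. A i) = (\<Prod>i\<in>J. prob (A i))" if "finite J" "J \<noteq> {}" for J
    using A that by (auto simp: indep_events_def)
  show "(\<Inter>i\<in>I k. A i) \<in> events" for k
    using I ev by (intro sets.finite_INT) auto
  fix J :: "'k set" assume J: "J \<subseteq> UNIV" "finite J" "J \<noteq> {}"
  have "(\<Inter>k\<in>J. \<Inter>i\<in>I k. A i) = (\<Inter>i\<in>(\<Union>k\<in>J. I k). A i)"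
    by auto
  also have "prob \<dots> = (\<Prod>i\<in>(\<Union>k\<in>J. I k). prob (A i))"
    using I J by (intro *) auto
  also have "\<dots> = (\<Prod>k\<in>J. \<Prod>i\<in>I k. prob (A i))"
    using I J by (intro prod.UNION_disjoint) (auto simp: disjoint_family_on_def)
  also have "\<dots> = (\<Prod>k\<in>J. prob (\<Inter>i\<in>I k. A i))"
    using I by (simp add: *)
  finally show "prob (\<Inter>k\<in>J. \<Inter>i\<in>I k. A i) = (\<Prod>k\<in>J. prob (\<Inter>i\<in>I k. A i))" .
qed

text \<open>By the zero-one law, otherwise almost surely only finitely many events occur, so their
  limit superior is null. But by continuity from above it has probability at least
  \<open>p\<close>.\<close>

lemma (in prob_space) AE_infinite_if_indep_prob_ge:
  fixes P :: "nat \<Rightarrow> 'a \<Rightarrow> bool"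
  assumes ind: "indep_events (\<lambda>k. {\<omega>\<in>space M. P k \<omega>}) UNIV"
    and "0 < p" and p: "\<And>k. p \<le> prob {\<omega>\<in>space M. P k \<omega>}"
  shows "AE \<omega> in M. infinite {k. P k \<omega>}"
proof (rule ccontr)
  assume "\<not> ?thesis"
  then have fin: "AE \<omega> in M. finite {k. P k \<omega>}"
    using borel_0_1_law_AE[OF ind] by blast
  define E where "E k = {\<omega>\<in>space M. P k \<omega>}" for k
  have E [measurable]: "E k \<in> events" for k
    using ind by (auto simp: indep_events_def E_def)
  let ?Q = "\<lambda>n. \<Union>k\<in>{n..}. E k"
  have Q: "?Q n \<in> events" for n
    by measurable
  have "p \<le> prob (?Q n)" for n
    using p[of n] Q[of n] by (intro order_trans[OF p finite_measure_mono]) (auto simp: E_def)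
  moreover have "(\<lambda>n. prob (?Q n)) \<longlonglongrightarrow> prob (\<Inter>n. ?Q n)"
    using Q by (intro finite_Lim_measure_decseq) (auto simp: decseq_def intro: order_trans)
  ultimately have "p \<le> prob (\<Inter>n. ?Q n)"
    by (intro LIMSEQ_le_const) auto
  moreover have "prob (\<Inter>n. ?Q n) = 0"
  proof -
    have "AE \<omega> in M. \<omega> \<notin> (\<Inter>n. ?Q n)"
      using fin
    proof eventually_elim
      case (elim \<omega>)
      then obtain n where "\<forall>k\<in>{k. P k \<omega>}. k < n"
        by (metis finite_nat_set_iff_bounded)
      then have "\<omega> \<notin> ?Q n"
        by (auto simp: E_def)
      then show ?case
        by blast
    qed
    then show ?thesis
      using Q by (subst prob_eq_0) auto
  qed
  ultimately show False
    using \<open>0 < p\<close> by simp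
qed

context wiener_process
begin

text \<open>The level \<open>m\<close> grids of consecutive intervals concatenate to one increasing
  sequence of times \<open>\<sigma>\<close>. The \<open>i\<close>-th event depends only on the
  \<open>i\<close>-th group of \<open>2 ^ m\<close> increments along it, and disjoint groups of
  independent increments are independent.\<close>

lemma indep_tracks_upto:
  fixes \<tau> g d K :: "nat \<Rightarrow> real"
  assumes \<tau>: "strict_mono \<tau>" "\<And>i. \<tau> i \<in> {0..1}"
  shows "indep_events (\<lambda>i. {\<omega>\<in>space M. tracks_upto m (\<lambda>t. W t \<omega>) (\<tau> i) (\<tau> (Suc i)) (g i) (d i) (K i)}) {..<n}"
proof -
  define B where "B = (2::nat) ^ m"
  have "0 < B" by (simp add: B_def)
  define \<sigma> where "\<sigma> l = dyadic (\<tau> (l div B)) (\<tau> (Suc (l div B))) m (l mod B)" for l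
  have dyB: "dyadic a b m B = b" for a b
    by (simp add: dyadic_def B_def)
  \<comment> \<open>The case \<open>j = B\<close> matters: there the quotient jumps to
    \<open>Suc i\<close>, and the formula holds because the next grid starts where this one
    ends.\<close>
  have \<sigma>: "\<sigma> (i * B + j) = dyadic (\<tau> i) (\<tau> (Suc i)) m j" if "j \<le> B" for i j
  proof (cases "j = B")
    case True
    have "\<sigma> (Suc i * B) = \<tau> (Suc i)"
      using \<open>0 < B\<close> unfolding \<sigma>_def by (simp only: nonzero_mult_div_cancel_right mod_mult_self2_is_0 dyadic_0)
    then show ?thesis
      using True dyB by (simp add: add.commute)
  next
    case False
    then have "j < B" using that by simp
    then have "(i * B + j) div B = i" "(i * B + j) mod B = j"
      by auto
    then show ?thesis
      by (simp only: \<sigma>_def)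
  qed
  have mono: "\<sigma> l < \<sigma> (Suc l)" for l
  proof -
    have l: "l = l div B * B + l mod B" "l mod B < B"
      using \<open>0 < B\<close> by auto
    have "\<sigma> l = dyadic (\<tau> (l div B)) (\<tau> (Suc (l div B))) m (l mod B)"
      by (simp add: \<sigma>_def)
    also have "\<dots> < dyadic (\<tau> (l div B)) (\<tau> (Suc (l div B))) m (Suc (l mod B))"
      using strict_monoD[OF \<tau>(1), of "l div B" "Suc (l div B)"] unfolding dyadic_def
      by (intro add_strict_left_mono divide_strict_right_mono mult_strict_left_mono) auto
    also have "\<dots> = \<sigma> (l div B * B + Suc (l mod B))"
      using l by (intro \<sigma>[symmetric]) simp
    also have "l div B * B + Suc (l mod B) = Suc l"
      using l by simp
    finally show ?thesis .
  qed
  define X where "X l \<omega> = W (\<sigma> (Suc l)) \<omega> - W (\<sigma> l) \<omega>" for l \<omega>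
  have X: "indep_vars (\<lambda>_. borel) X {..<n * B}"
    unfolding X_def
  proof (rule indep_increments)
    show "0 \<le> \<sigma> 0" "\<sigma> (n * B) \<le> 1"
      using \<tau>(2)[of 0] \<tau>(2)[of n] \<sigma>[of 0 0] \<sigma>[of 0 n] by auto
  qed (rule mono)
  define L where "L i = {i * B..<i * B + B}" for i
  have L: "L i \<subseteq> {..<n * B}" if "i \<in> {..<n}" for i
    using mult_le_mono1[of "Suc i" n B] that by (auto simp: L_def)
  have disj: "disjoint_family_on L {..<n}"
  proof -
    have "l div B = i" if "l \<in> L i" for l i
      using that \<open>0 < B\<close> unfolding L_def
      by (intro div_nat_eqI) (auto simp: algebra_simps)
    then show ?thesis
      by (auto simp: disjoint_family_on_def)
  qed
  have ind: "indep_vars (\<lambda>i. PiM (L i) (\<lambda>_. borel)) (\<lambda>i \<omega>. restrict (\<lambda>l. X l \<omega>) (L i)) {..<n}"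
    by (rule indep_vars_restrict[OF X L disj])
  \<comment> \<open>Telescoping: these partial sums recover the displacement of \<open>W\<close>
    from \<open>\<tau> i\<close> to the \<open>j\<close>-th grid point out of the increments
    alone.\<close>
  define S where "S i j y = (\<Sum>l\<in>{i * B..<i * B + j}. y l)" for i j and y :: "nat \<Rightarrow> real"
  define P where "P i y \<longleftrightarrow> \<bar>S i B y - g i\<bar> \<le> d i \<and> (\<forall>j\<le>B. \<bar>S i j y\<bar> \<le> K i)" for i y
  have "indep_events (\<lambda>i. {\<omega>\<in>space M. P i (restrict (\<lambda>l. X l \<omega>) (L i))}) {..<n}"
  proof (rule indep_eventsI_indep_vars[OF ind])
    fix i
    have [measurable]: "S i j \<in> borel_measurable (PiM (L i) (\<lambda>_. borel))" if "j \<le> B" for j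
      unfolding S_def using that
      by (intro borel_measurable_sum measurable_component_singleton) (auto simp: L_def)
    have "{y \<in> space (PiM (L i) (\<lambda>_. borel)). \<forall>j\<in>{..B}. \<bar>S i j y\<bar> \<le> K i} \<in> sets (PiM (L i) (\<lambda>_. borel))"
      by (intro sets.sets_Collect_finite_All) auto
    moreover have "{y \<in> space (PiM (L i) (\<lambda>_. borel)). \<bar>S i B y - g i\<bar> \<le> d i} \<in> sets (PiM (L i) (\<lambda>_. borel))"
      by simp
    ultimately show "{y \<in> space (PiM (L i) (\<lambda>_. borel)). P i y} \<in> sets (PiM (L i) (\<lambda>_. borel))"
      unfolding P_def by (intro sets.sets_Collect_conj) (auto simp: Ball_def)
  qed
  moreover have "P i (restrict (\<lambda>l. X l \<omega>) (L i)) \<longleftrightarrow>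
    tracks_upto m (\<lambda>t. W t \<omega>) (\<tau> i) (\<tau> (Suc i)) (g i) (d i) (K i)" for i \<omega>
  proof -
    have S: "S i j (restrict (\<lambda>l. X l \<omega>) (L i)) = W (dyadic (\<tau> i) (\<tau> (Suc i)) m j) \<omega> - W (\<tau> i) \<omega>"
      if "j \<le> B" for j
    proof -
      have "S i j (restrict (\<lambda>l. X l \<omega>) (L i)) = (\<Sum>l\<in>{i * B..<i * B + j}. X l \<omega>)"
        unfolding S_def using that by (intro sum.cong) (auto simp: L_def)
      also have "\<dots> = W (\<sigma> (i * B + j)) \<omega> - W (\<sigma> (i * B)) \<omega>"
        unfolding X_def by (intro sum_Suc_diff') simp
      finally show ?thesis
        using \<sigma>[OF that] \<sigma>[of 0] by simp
    qed
    show ?thesis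
      unfolding P_def tracks_upto_def using S by (auto simp: dyB B_def[symmetric])
  qed
  ultimately show ?thesis
    by simp
qed

text \<open>Each event is the intersection of the decreasing level \<open>m\<close> events, so the
  product formula for a finite index set survives as \<open>m\<close> tends to infinity.\<close>

lemma indep_tracks:
  fixes \<tau> g d K :: "nat \<Rightarrow> real"
  assumes \<tau>: "strict_mono \<tau>" "\<And>i. \<tau> i \<in> {0..1}"
  shows "indep_events (\<lambda>i. {\<omega>\<in>space M. tracks (\<lambda>t. W t \<omega>) (\<tau> i) (\<tau> (Suc i)) (g i) (d i) (K i)}) UNIV"
proof (rule indep_eventsI)
  define F where "F m i = {\<omega>\<in>space M. tracks_upto m (\<lambda>t. W t \<omega>) (\<tau> i) (\<tau> (Suc i)) (g i) (d i) (K i)}" for m i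
  define T where "T i = {\<omega>\<in>space M. tracks (\<lambda>t. W t \<omega>) (\<tau> i) (\<tau> (Suc i)) (g i) (d i) (K i)}" for i
  have \<tau>': "0 \<le> \<tau> i" "\<tau> i < \<tau> (Suc i)" "\<tau> (Suc i) \<le> 1" for i
    using \<tau>(2)[of i] \<tau>(2)[of "Suc i"] strict_monoD[OF \<tau>(1), of i "Suc i"] by auto
  have F: "F m i \<in> events" for m i
    unfolding F_def by (rule sets_tracks_upto[OF \<tau>'])
  show "{\<omega>\<in>space M. tracks (\<lambda>t. W t \<omega>) (\<tau> i) (\<tau> (Suc i)) (g i) (d i) (K i)} \<in> events" for i
    by (rule sets_tracks[OF \<tau>'])
  have decF: "F m' i \<subseteq> F m i" if "m \<le> m'" for m m' i
    using that by (induction rule: dec_induct) (auto simp: F_def dest: tracks_upto_antimono)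
  have TF: "T i = (\<Inter>m. F m i)" for i
    by (auto simp: T_def F_def tracks_def)
  have lim: "(\<lambda>m. prob (\<Inter>i\<in>J. F m i)) \<longlonglongrightarrow> prob (\<Inter>i\<in>J. T i)" if "finite J" "J \<noteq> {}" for J
  proof -
    have "(\<Inter>i\<in>J. T i) = (\<Inter>m. \<Inter>i\<in>J. F m i)"
      by (auto simp: TF)
    moreover have "(\<lambda>m. prob (\<Inter>i\<in>J. F m i)) \<longlonglongrightarrow> prob (\<Inter>m. \<Inter>i\<in>J. F m i)"
    proof (rule finite_Lim_measure_decseq)
      show "range (\<lambda>m. \<Inter>i\<in>J. F m i) \<subseteq> events"
        using that F by (auto intro!: sets.finite_INT)
      show "decseq (\<lambda>m. \<Inter>i\<in>J. F m i)"
        unfolding decseq_def using decF by blast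
    qed
    ultimately show ?thesis by simp
  qed
  fix J :: "nat set" assume J: "J \<subseteq> UNIV" "finite J" "J \<noteq> {}"
  then obtain n where n: "J \<subseteq> {..<n}"
    by (metis finite_nat_bounded)
  have "prob (\<Inter>i\<in>J. F m i) = (\<Prod>i\<in>J. prob (F m i))" for m
    using indep_tracks_upto[OF \<tau>, of m g d K n] n J unfolding indep_events_def F_def by blast
  moreover have "(\<lambda>m. \<Prod>i\<in>J. prob (F m i)) \<longlonglongrightarrow> (\<Prod>i\<in>J. prob (T i))"
    using lim[of "{i}" for i] by (intro tendsto_prod) simp
  ultimately have "prob (\<Inter>i\<in>J. T i) = (\<Prod>i\<in>J. prob (T i))"
    using lim[OF J(2,3)] by (simp add: LIMSEQ_unique)
  then show "prob (\<Inter>i\<in>J. {\<omega>\<in>space M. tracks (\<lambda>t. W t \<omega>) (\<tau> i) (\<tau> (Suc i)) (g i) (d i) (K i)}) =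
    (\<Prod>i\<in>J. prob {\<omega>\<in>space M. tracks (\<lambda>t. W t \<omega>) (\<tau> i) (\<tau> (Suc i)) (g i) (d i) (K i)})"
    by (simp only: T_def)
qed

end

section \<open>Oscillations at infinitely many scales\<close>

text \<open>The triangle wave between 0 and \<open>r\<close> with slopes 1 and -1 and period
  \<open>2 * r\<close>.\<close>

definition zigzag :: "nat \<Rightarrow> nat \<Rightarrow> real" where
  "zigzag r j = (if even (j div r) then real (j mod r) else real r - real (j mod r))"

text \<open>For \<open>b \<le> N\<close> these points cut the interval from
  \<open>1 - 1 / 2 ^ k\<close> to \<open>1 - 1 / 2 ^ Suc k\<close> into \<open>N\<close> equal
  blocks; the intervals are adjacent and accumulate at 1.\<close>

definition block_point :: "nat \<Rightarrow> nat \<Rightarrow> nat \<Rightarrow> real" where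
  "block_point N k b = 1 - 1 / 2 ^ k + b / (N * 2 ^ Suc k)"

text \<open>The square root of the length of the \<open>k\<close>-th interval, which is the typical
  size of a Brownian displacement over it.\<close>

definition scale :: "nat \<Rightarrow> real" where
  "scale k = sqrt (1 / 2 ^ Suc k)"

text \<open>On the \<open>k\<close>-th interval, whose length is \<open>(scale k)\<^sup>2\<close>, the path \<open>w\<close> follows a triangle wave
  with \<open>N / r\<close> legs of height \<open>scale k\<close>; a leg consists of \<open>r\<close> of the \<open>N\<close> blocks.\<close>

definition zigzags :: "nat \<Rightarrow> nat \<Rightarrow> real \<Rightarrow> nat \<Rightarrow> (real \<Rightarrow> real) \<Rightarrow> bool" where
  "zigzags N r \<epsilon> k w \<longleftrightarrow> (\<forall>b<N. tracks w (block_point N k b) (block_point N k (Suc b))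
     ((zigzag r (Suc b) - zigzag r b) * scale k / r) (\<epsilon> * scale k / N) (\<epsilon> * scale k))"

lemma scale_pos: "0 < scale k"
  by (simp add: scale_def)

lemma zigzag_nonneg: "0 < r \<Longrightarrow> 0 \<le> zigzag r j"
  by (simp add: zigzag_def less_imp_le)

lemma zigzag_even: "0 < r \<Longrightarrow> zigzag r (2 * i * r) = 0"
  by (simp add: zigzag_def)

lemma zigzag_odd: "0 < r \<Longrightarrow> zigzag r (Suc (2 * i) * r) = r"
  unfolding zigzag_def by (simp only: nonzero_mult_div_cancel_right mod_mult_self2_is_0) simp

lemma abs_zigzag_step:
  assumes "0 < r"
  shows "\<bar>zigzag r (Suc j) - zigzag r j\<bar> = 1"
proof (cases "Suc (j mod r) = r")
  case True
  then have "Suc j mod r = 0" "Suc j div r = Suc (j div r)"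
    by (auto simp: mod_Suc div_Suc)
  moreover have "real r = real (j mod r) + 1"
    using True by linarith
  ultimately show ?thesis
    by (simp add: zigzag_def)
next
  case False
  then have "Suc j mod r = Suc (j mod r)" "Suc j div r = j div r"
    by (auto simp: mod_Suc div_Suc)
  then show ?thesis
    by (simp add: zigzag_def)
qed

lemma block_point_next: "0 < N \<Longrightarrow> block_point N k N = block_point N (Suc k) 0"
  by (simp add: block_point_def field_simps)

lemma block_point_Suc:
  assumes "0 < N"
  shows "block_point N k (Suc b) - block_point N k b = (scale k)\<^sup>2 / N"
  using assms by (simp add: block_point_def scale_def add_divide_distrib)

lemma block_point_in:
  assumes "0 < N" "b \<le> N"
  shows "block_point N k b \<in> {0..1}"
proof -
  have "real b / (N * 2 ^ Suc k) \<le> real N / (N * 2 ^ Suc k)"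
    using assms by (intro divide_right_mono) auto
  also have "\<dots> \<le> 1 / 2 ^ k"
    using assms by (simp add: field_simps)
  finally show ?thesis
    using assms by (simp add: block_point_def)
qed

context wiener_process
begin

text \<open>With \<open>s = scale k\<close>, a block has standard deviation \<open>s / R\<close>.
  Both the prescribed increment \<open>s / r\<close> and the tolerance are at most half of it, so
  the block estimate applies; then \<open>s\<close> cancels and the bound is the same for all
  \<open>k\<close>.\<close>

lemma prob_block_ge:
  fixes R q N r b k :: nat and \<epsilon> :: real
  assumes R: "2 \<le> R" "2 \<le> q" "0 < \<epsilon>" "\<epsilon> \<le> 1" and N: "N = R * R" and r: "r = R * q" and "b < N"
  shows "2 * \<epsilon> / (5 * R) - 100000 / (R * \<epsilon>) ^ 4 \<le>
    prob {\<omega>\<in>space M. tracks (\<lambda>t. W t \<omega>) (block_point N k b) (block_point N k (Suc b))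
     ((zigzag r (Suc b) - zigzag r b) * scale k / r) (\<epsilon> * scale k / N) (\<epsilon> * scale k)}"
proof -
  define s where "s = scale k"
  have "0 < s" by (simp add: s_def scale_pos)
  have "0 < N" "0 < r" using R by (auto simp: N r)
  define a where "a = block_point N k b"
  define c where "c = block_point N k (Suc b)"
  define g where "g = (zigzag r (Suc b) - zigzag r b) * s / r"
  have ca: "c - a = (s / R)\<^sup>2"
    using block_point_Suc[OF \<open>0 < N\<close>] by (simp add: a_def c_def s_def N power2_eq_square)
  then have sq: "sqrt (c - a) = s / R"
    using \<open>0 < s\<close> by simp
  have "0 < c - a"
    unfolding ca using \<open>0 < s\<close> R by simp
  then have ac: "0 \<le> a" "a < c" "c \<le> 1"
    using block_point_in[OF \<open>0 < N\<close>, of b k] block_point_in[OF \<open>0 < N\<close>, of "Suc b" k] \<open>b < N\<close>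
    by (auto simp: a_def c_def)
  have "\<bar>g\<bar> = s / r"
    using \<open>0 < s\<close> abs_zigzag_step[OF \<open>0 < r\<close>, of b] by (simp add: g_def abs_mult)
  also have "s / r \<le> s / R * (1/2)"
    using R \<open>0 < s\<close> by (simp add: r field_simps)
  finally have "\<bar>g\<bar> \<le> s / R * (1/2)" .
  moreover have "\<epsilon> * s / N \<le> s / R * (1/2)"
  proof -
    have "\<epsilon> / R \<le> 1 / 2"
      using R by (intro frac_le) auto
    then have "s / R * (\<epsilon> / R) \<le> s / R * (1/2)"
      using \<open>0 < s\<close> by (intro mult_left_mono) auto
    then show ?thesis by (simp add: N mult.commute)
  qed
  ultimately have "\<bar>g\<bar> + \<epsilon> * s / N \<le> sqrt (c - a)"
    unfolding sq by (simp add: field_simps)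
  then have "2 * (\<epsilon> * s / N) / (5 * sqrt (c - a)) - 100000 * (c - a)\<^sup>2 / (\<epsilon> * s) ^ 4
    \<le> prob {\<omega>\<in>space M. tracks (\<lambda>t. W t \<omega>) a c g (\<epsilon> * s / N) (\<epsilon> * s)}"
    using R \<open>0 < s\<close> by (intro prob_tracks_ge ac) auto
  moreover have "2 * (\<epsilon> * s / N) / (5 * sqrt (c - a)) = 2 * \<epsilon> / (5 * R)"
    unfolding sq using \<open>0 < s\<close> R by (simp add: N)
  moreover have "100000 * (c - a)\<^sup>2 / (\<epsilon> * s) ^ 4 = 100000 / (R * \<epsilon>) ^ 4"
    unfolding ca using \<open>0 < s\<close> R
    by (simp add: power_divide power_mult_distrib flip: power_mult)
  ultimately show ?thesis
    by (simp add: a_def c_def g_def s_def)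
qed

lemma indep_zigzags:
  assumes "0 < N"
  shows "indep_events (\<lambda>k. {\<omega>\<in>space M. zigzags N r \<epsilon> k (\<lambda>t. W t \<omega>)}) UNIV"
    and "prob {\<omega>\<in>space M. zigzags N r \<epsilon> k (\<lambda>t. W t \<omega>)} =
      (\<Prod>b<N. prob {\<omega>\<in>space M. tracks (\<lambda>t. W t \<omega>) (block_point N k b) (block_point N k (Suc b))
     ((zigzag r (Suc b) - zigzag r b) * scale k / r) (\<epsilon> * scale k / N) (\<epsilon> * scale k)})"
proof -
  define A where "A k b = {\<omega>\<in>space M. tracks (\<lambda>t. W t \<omega>) (block_point N k b) (block_point N k (Suc b))
     ((zigzag r (Suc b) - zigzag r b) * scale k / r) (\<epsilon> * scale k / N) (\<epsilon> * scale k)}" for k b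
  define \<tau> where "\<tau> l = block_point N (l div N) (l mod N)" for l
  \<comment> \<open>The last block of an interval ends where the next interval begins, so both
    endpoints of block \<open>l\<close> can be written with the index of its own interval.\<close>
  have \<tau>: "\<tau> l = block_point N (l div N) (l mod N)" "\<tau> (Suc l) = block_point N (l div N) (Suc (l mod N))" for l
    using assms by (auto simp: \<tau>_def mod_Suc div_Suc block_point_next)
  have "strict_mono \<tau>"
  proof (rule strict_monoI_Suc)
    fix l
    have "0 < (scale (l div N))\<^sup>2 / N"
      using assms scale_pos[of "l div N"] by simp
    then show "\<tau> l < \<tau> (Suc l)"
      using block_point_Suc[OF assms, of "l div N" "l mod N"] \<tau>[of l] by linarith
  qed
  moreover have "\<tau> l \<in> {0..1}" for l
    unfolding \<tau>_def using assms by (intro block_point_in) auto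
  ultimately have ind: "indep_events (\<lambda>l. A (l div N) (l mod N)) UNIV"
    unfolding A_def \<tau>[symmetric] by (rule indep_tracks)
  define I where "I k = {l. l div N = k}" for k
  have I: "I k = (\<lambda>b. k * N + b) ` {..<N}" for k
  proof safe
    fix l assume "l \<in> I k"
    then have k: "l div N = k"
      by (simp add: I_def)
    have "l = k * N + l mod N" "l mod N \<in> {..<N}"
      using div_mult_mod_eq[of l N] assms unfolding k by simp_all
    then show "l \<in> (\<lambda>b. k * N + b) ` {..<N}"
      by blast
  qed (use assms in \<open>auto simp: I_def\<close>)
  have fin: "finite (I k)" "I k \<noteq> {}" for k
    using assms by (auto simp: I)
  have E: "(\<Inter>l\<in>I k. A (l div N) (l mod N)) = {\<omega>\<in>space M. zigzags N r \<epsilon> k (\<lambda>t. W t \<omega>)}" for k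
    using assms by (auto simp: I A_def zigzags_def)
  have "disjoint_family I"
    by (auto simp: disjoint_family_on_def I_def)
  from indep_events_INT_blocks[OF ind fin this]
  show "indep_events (\<lambda>k. {\<omega>\<in>space M. zigzags N r \<epsilon> k (\<lambda>t. W t \<omega>)}) UNIV"
    unfolding E .
  have "prob (\<Inter>l\<in>I k. A (l div N) (l mod N)) = (\<Prod>l\<in>I k. prob (A (l div N) (l mod N)))"
    using ind fin[of k] unfolding indep_events_def by blast
  also have "\<dots> = (\<Prod>b<N. prob (A k b))"
    unfolding I by (subst prod.reindex) (auto simp: inj_on_def)
  finally show "prob {\<omega>\<in>space M. zigzags N r \<epsilon> k (\<lambda>t. W t \<omega>)} =
      (\<Prod>b<N. prob {\<omega>\<in>space M. tracks (\<lambda>t. W t \<omega>) (block_point N k b) (block_point N k (Suc b))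
     ((zigzag r (Suc b) - zigzag r b) * scale k / r) (\<epsilon> * scale k / N) (\<epsilon> * scale k)})"
    unfolding E by (simp only: A_def)
qed

lemma AE_infinite_zigzags:
  assumes n: "0 < n" and \<epsilon>: "0 < \<epsilon>" "\<epsilon> \<le> 1"
  shows "\<exists>r>0. AE \<omega> in M. infinite {k. zigzags (2 * n * r) r \<epsilon> k (\<lambda>t. W t \<omega>)}"
proof -
  \<comment> \<open>Positivity of \<open>p\<close> below amounts to
    \<open>250000 < R ^ 3 * \<epsilon> ^ 5\<close>, which follows from
    \<open>q \<le> R \<le> R ^ 3\<close>. The factor \<open>2 * n\<close> in \<open>R\<close> makes
    the \<open>R * R\<close> blocks split into exactly \<open>2 * n\<close> legs of
    \<open>r = R * q\<close> blocks.\<close>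
  obtain q0 :: nat where q0: "250000 / \<epsilon> ^ 5 < q0"
    using reals_Archimedean2 by blast
  define q where "q = max q0 2"
  define R where "R = 2 * n * q"
  define r where "r = R * q"
  define N where "N = R * R"
  have q: "2 \<le> q" "250000 / \<epsilon> ^ 5 < q"
    using q0 by (auto simp: q_def)
  have R: "q \<le> R" "2 \<le> R"
    using q n by (auto simp: R_def)
  have N: "N = 2 * n * r" "0 < N" "0 < r"
    using R q by (auto simp: N_def r_def R_def)
  define p where "p = 2 * \<epsilon> / (5 * R) - 100000 / (R * \<epsilon>) ^ 4"
  have "0 < p"
  proof -
    have "250000 / \<epsilon> ^ 5 < real R"
      using q(2) R(1) by linarith
    also have "\<dots> \<le> real R ^ 3"
      using R by (intro self_le_power) auto
    finally have "250000 < real R ^ 3 * \<epsilon> ^ 5"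
      using \<epsilon> by (simp add: field_simps)
    then have "2 * real R * 250000 < 2 * real R * (real R ^ 3 * \<epsilon> ^ 5)"
      using R by (intro mult_strict_left_mono) auto
    also have "\<dots> = 2 * \<epsilon> * (R * \<epsilon>) ^ 4"
      using power_add[of \<epsilon> 1 4] power_add[of "real R" 1 3]
      by (simp only: power_mult_distrib power_one_right) simp
    finally have "100000 * (5 * R) < 2 * \<epsilon> * (R * \<epsilon>) ^ 4"
      by linarith
    moreover have "a / x < e / y" if "a * y < e * x" "0 < x" "0 < y" for a x e y :: real
      using that by (simp add: field_simps)
    ultimately have "100000 / (R * \<epsilon>) ^ 4 < 2 * \<epsilon> / (5 * R)"
      using R \<epsilon> by simp
    then show ?thesis
      by (simp add: p_def)
  qed
  have "p ^ N \<le> prob {\<omega>\<in>space M. zigzags N r \<epsilon> k (\<lambda>t. W t \<omega>)}" for k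
  proof -
    have "p ^ N = (\<Prod>b<N. p)" by simp
    also have "\<dots> \<le> prob {\<omega>\<in>space M. zigzags N r \<epsilon> k (\<lambda>t. W t \<omega>)}"
      unfolding indep_zigzags(2)[OF \<open>0 < N\<close>]
    proof (rule prod_mono)
      fix b assume "b \<in> {..<N}"
      then show "0 \<le> p \<and> p \<le> prob {\<omega>\<in>space M. tracks (\<lambda>t. W t \<omega>) (block_point N k b) (block_point N k (Suc b))
       ((zigzag r (Suc b) - zigzag r b) * scale k / r) (\<epsilon> * scale k / N) (\<epsilon> * scale k)}"
        using \<open>0 < p\<close> prob_block_ge[OF R(2) q(1) \<epsilon> N_def r_def, of b k] by (simp add: p_def)
    qed
    finally show ?thesis .
  qed
  then have "AE \<omega> in M. infinite {k. zigzags N r \<epsilon> k (\<lambda>t. W t \<omega>)}"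
    using \<open>0 < p\<close> by (intro AE_infinite_if_indep_prob_ge[OF indep_zigzags(1)[OF \<open>0 < N\<close>], of "p ^ N"]) auto
  then show ?thesis
    using N by auto
qed

end

text \<open>Rounding down to the dyadic grids gives points converging to \<open>t\<close>, and
  continuity carries the bound to the limit.\<close>

lemma tracks_oscillation:
  assumes cont: "continuous_on {a..b} w" and "a < b" and tr: "tracks w a b g d K" and t: "t \<in> {a..b}"
  shows "\<bar>w t - w a\<bar> \<le> K"
proof -
  define x where "x = (t - a) / (b - a)"
  have x: "0 \<le> x" "x \<le> 1" "t = a + (b - a) * x"
    using t \<open>a < b\<close> by (auto simp: x_def field_simps)
  define j where "j m = nat \<lfloor>x * 2 ^ m\<rfloor>" for m
  have j: "real (j m) \<le> x * 2 ^ m" "x * 2 ^ m - 1 \<le> real (j m)" for m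
    using x(1) by (auto simp: j_def le_nat_floor of_nat_floor intro: less_imp_le)
  have j_le: "j m \<le> 2 ^ m" for m
  proof -
    have "real (j m) \<le> 1 * 2 ^ m"
      using j(1)[of m] x(2) by (meson mult_right_mono order_trans zero_le_numeral zero_le_power)
    then have "real (j m) \<le> real (2 ^ m)" by simp
    then show ?thesis by (simp only: of_nat_le_iff)
  qed
  have "(\<lambda>m. real (j m) / 2 ^ m) \<longlonglongrightarrow> x"
  proof (rule tendsto_sandwich[of "\<lambda>m. x - 1 / 2 ^ m" _ _ "\<lambda>_. x"])
    have "(\<lambda>m. x - 1 / 2 ^ m) \<longlonglongrightarrow> x - 0"
      by (intro tendsto_diff tendsto_const LIMSEQ_divide_realpow_zero) auto
    then show "(\<lambda>m. x - 1 / 2 ^ m) \<longlonglongrightarrow> x" by simp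
    show "\<forall>\<^sub>F m in sequentially. x - 1 / 2 ^ m \<le> real (j m) / 2 ^ m"
    proof (rule always_eventually, rule allI)
      fix m
      have "(x * 2 ^ m - 1) / 2 ^ m \<le> real (j m) / 2 ^ m"
        using j by (intro divide_right_mono) auto
      then show "x - 1 / 2 ^ m \<le> real (j m) / 2 ^ m"
        by (simp add: diff_divide_distrib)
    qed
    show "\<forall>\<^sub>F m in sequentially. real (j m) / 2 ^ m \<le> x"
      using j by (intro always_eventually allI) (simp add: pos_divide_le_eq)
  qed auto
  then have "(\<lambda>m. a + (b - a) * (real (j m) / 2 ^ m)) \<longlonglongrightarrow> a + (b - a) * x"
    by (intro tendsto_add tendsto_mult tendsto_const)
  then have "(\<lambda>m. dyadic a b m (j m)) \<longlonglongrightarrow> t"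
    by (simp add: dyadic_def x(3))
  moreover have "dyadic a b m (j m) \<in> {a..b}" for m
    using \<open>a < b\<close> j_le by (intro dyadic_in) auto
  ultimately have "(\<lambda>m. w (dyadic a b m (j m))) \<longlonglongrightarrow> w t"
    using t by (intro continuous_on_tendsto_compose[OF cont]) auto
  then have "(\<lambda>m. \<bar>w (dyadic a b m (j m)) - w a\<bar>) \<longlonglongrightarrow> \<bar>w t - w a\<bar>"
    by (intro tendsto_intros)
  moreover have "\<bar>w (dyadic a b m (j m)) - w a\<bar> \<le> K" for m
    using tr j_le by (simp add: tracks_def tracks_upto_def)
  ultimately show ?thesis
    by (intro LIMSEQ_le_const2) auto
qed

lemma mem_consecutive_interval:
  fixes f :: "nat \<Rightarrow> 'a :: linorder"
  assumes "x \<in> {f 0..f N}" "0 < N"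
  shows "\<exists>b<N. x \<in> {f b..f (Suc b)}"
  using assms
proof (induction N)
  case (Suc N)
  show ?case
  proof (cases "x \<le> f N \<and> 0 < N")
    case True
    then show ?thesis
      using Suc by (auto intro: less_SucI)
  next
    case False
    then have "f N \<le> x"
      using Suc.prems by (cases "N = 0") auto
    then show ?thesis
      using Suc.prems by auto
  qed
qed simp

section \<open>Stars in the tree of an oscillating path\<close>

text \<open>The centre of the resulting star is \<open>u\<close>, its tips are the peaks \<open>p 1, \<dots>, p n\<close>.\<close>

definition comb :: "(real \<Rightarrow> real) \<Rightarrow> real \<Rightarrow> real \<Rightarrow> real \<Rightarrow> real \<Rightarrow> nat \<Rightarrow> bool" where
  "comb f u v s \<kappa> n \<longleftrightarrow> u \<le> v \<and> (\<forall>t\<in>{u..v}. f u - \<kappa> * s \<le> f t) \<and>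
     (\<exists>p. (\<forall>i\<in>{1..n}. p i \<in> {u..v} \<and> \<bar>f (p i) - f u - s\<bar> \<le> \<kappa> * s) \<and>
       (\<forall>i\<in>{1..n}. \<forall>j\<in>{1..n}. i < j \<longrightarrow> (\<exists>t\<in>{p i..p j}. f t \<le> f u + \<kappa> * s)))"

text \<open>Needed because the cyclic shift acts on suitable intervals as a translation of time by
  \<open>c\<close> and of values by \<open>y\<close>.\<close>

lemma comb_translate:
  assumes "comb f u v s \<kappa> n" and g: "\<And>t. t \<in> {u..v} \<Longrightarrow> g (t + c) = f t - y"
  shows "comb g (u + c) (v + c) s \<kappa> n"
proof -
  obtain p where uv: "u \<le> v" and low: "\<And>t. t \<in> {u..v} \<Longrightarrow> f u - \<kappa> * s \<le> f t"
    and p: "\<And>i. i \<in> {1..n} \<Longrightarrow> p i \<in> {u..v} \<and> \<bar>f (p i) - f u - s\<bar> \<le> \<kappa> * s"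
    and valley: "\<And>i j. i \<in> {1..n} \<Longrightarrow> j \<in> {1..n} \<Longrightarrow> i < j \<Longrightarrow> \<exists>t\<in>{p i..p j}. f t \<le> f u + \<kappa> * s"
    using assms(1) unfolding comb_def by blast
  have gu: "g (u + c) = f u - y"
    using g uv by simp
  have "g (u + c) - \<kappa> * s \<le> g t" if "t \<in> {u + c..v + c}" for t
    using low[of "t - c"] g[of "t - c"] gu that by auto
  moreover have "p i + c \<in> {u + c..v + c} \<and> \<bar>g (p i + c) - g (u + c) - s\<bar> \<le> \<kappa> * s" if "i \<in> {1..n}" for i
    using p[OF that] g[of "p i"] gu by auto
  moreover have "\<exists>t\<in>{p i + c..p j + c}. g t \<le> g (u + c) + \<kappa> * s"
    if ij: "i \<in> {1..n}" "j \<in> {1..n}" "i < j" for i j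
  proof -
    obtain t where "t \<in> {p i..p j}" "f t \<le> f u + \<kappa> * s"
      using valley[OF ij] by blast
    then show ?thesis
      using p[OF ij(1)] p[OF ij(2)] g[of t] gu by (intro bexI[of _ "t + c"]) auto
  qed
  ultimately show ?thesis
    using uv unfolding comb_def by (intro conjI exI[of _ "\<lambda>i. p i + c"]) auto
qed

text \<open>Three errors of size \<open>\<epsilon> * s\<close> add up: the accumulated error at the
  nodes, the oscillation inside a block, and the drift. The drift is small because the interval has
  length \<open>s * s\<close> and \<open>s * \<bar>w 1\<bar> \<le> \<epsilon>\<close>.\<close>

lemma comb_bridge_if_zigzags:
  assumes cont: "continuous_on {0..1} w" and "0 < \<epsilon>" "0 < r" "0 < n"
    and zz: "zigzags (2 * n * r) r \<epsilon> k w" and small: "scale k * \<bar>w 1\<bar> \<le> \<epsilon>"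
  shows "comb (bridge w) (1 - 1 / 2 ^ k) (1 - 1 / 2 ^ Suc k) (scale k) (3 * \<epsilon>) n"
proof -
  define N where "N = 2 * n * r"
  have N: "0 < N" using assms by (simp add: N_def)
  define s where "s = scale k"
  have "0 < s" by (simp add: s_def scale_pos)
  define a where "a = block_point N k"
  have a0: "a 0 = 1 - 1 / 2 ^ k" and aN: "a N = 1 - 1 / 2 ^ Suc k"
    using block_point_next[OF N, of k] by (simp_all add: a_def block_point_def)
  have tr: "tracks w (a b) (a (Suc b)) ((zigzag r (Suc b) - zigzag r b) * s / r) (\<epsilon> * s / N) (\<epsilon> * s)"
    if "b < N" for b
    using zz that unfolding zigzags_def a_def s_def N_def by blast
  have a_in: "a b \<in> {0..1}" if "b \<le> N" for b
    using block_point_in[OF N that] by (simp add: a_def)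
  have a_Suc: "a b < a (Suc b)" for b
    using block_point_Suc[OF N, of k b] \<open>0 < s\<close> N unfolding a_def s_def[symmetric]
    by (smt (verit) divide_pos_pos of_nat_0_less_iff zero_less_power)
  have a_mono: "a b \<le> a b'" if "b \<le> b'" for b b'
    using that by (rule lift_Suc_mono_le[of a, rotated]) (simp add: a_Suc less_imp_le)
  \<comment> \<open>Errors add from block to block, which is why each of the \<open>N\<close> blocks
    is allowed only \<open>\<epsilon> * s / N\<close>.\<close>
  have "\<bar>w (a b) - w (a 0) - zigzag r b * s / r\<bar> \<le> b * (\<epsilon> * s / N)" if "b \<le> N" for b
    using that
  proof (induction b)
    case 0
    then show ?case by (simp add: zigzag_def)
  next
    case (Suc b)
    have "\<bar>w (a (Suc b)) - w (a b) - (zigzag r (Suc b) - zigzag r b) * s / r\<bar> \<le> \<epsilon> * s / N"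
      using tr[of b] Suc.prems by (simp add: tracks_def tracks_upto_def)
    moreover have "\<bar>w (a b) - w (a 0) - zigzag r b * s / r\<bar> \<le> b * (\<epsilon> * s / N)"
      using Suc by simp
    moreover have "(zigzag r (Suc b) - zigzag r b) * s / r = zigzag r (Suc b) * s / r - zigzag r b * s / r"
      by (simp add: left_diff_distrib diff_divide_distrib)
    moreover have "real (Suc b) * (\<epsilon> * s / N) = b * (\<epsilon> * s / N) + \<epsilon> * s / N"
      by (simp only: of_nat_Suc distrib_right mult_1_left add.commute)
    ultimately show ?case by linarith
  qed
  moreover have "b * (\<epsilon> * s / N) \<le> \<epsilon> * s" if "b \<le> N" for b
  proof -
    have "b * (\<epsilon> * s / N) \<le> N * (\<epsilon> * s / N)"
      using that \<open>0 < \<epsilon>\<close> \<open>0 < s\<close> by (intro mult_right_mono) auto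
    then show ?thesis using N by simp
  qed
  ultimately have grid: "\<bar>w (a b) - w (a 0) - zigzag r b * s / r\<bar> \<le> \<epsilon> * s" if "b \<le> N" for b
    using that by (meson order_trans)
  have drift: "\<bar>(bridge w t - bridge w (a 0)) - (w t - w (a 0))\<bar> \<le> \<epsilon> * s" if "t \<in> {a 0..a N}" for t
  proof -
    have "a N - a 0 = s * s"
      unfolding a0 aN by (simp add: s_def scale_def)
    then have "\<bar>t - a 0\<bar> \<le> s * s"
      using that by auto
    then have "\<bar>t - a 0\<bar> * \<bar>w 1\<bar> \<le> s * (s * \<bar>w 1\<bar>)"
      by (metis abs_ge_zero mult.assoc mult_right_mono)
    also have "\<dots> \<le> s * \<epsilon>"
      using small \<open>0 < s\<close> unfolding s_def by (intro mult_left_mono) auto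
    finally have "\<bar>(t - a 0) * w 1\<bar> \<le> \<epsilon> * s"
      by (simp add: abs_mult mult.commute)
    moreover have "(bridge w t - bridge w (a 0)) - (w t - w (a 0)) = - ((t - a 0) * w 1)"
      by (simp add: bridge_def algebra_simps)
    ultimately show ?thesis by simp
  qed
  have node: "\<bar>bridge w (a b) - bridge w (a 0) - zigzag r b * s / r\<bar> \<le> 3 * \<epsilon> * s" if "b \<le> N" for b
    using grid[OF that] drift[of "a b"] a_mono[of 0 b] a_mono[OF that] mult_pos_pos[OF \<open>0 < \<epsilon>\<close> \<open>0 < s\<close>]
    by auto
  have low: "bridge w (a 0) - 3 * \<epsilon> * s \<le> bridge w t" if t: "t \<in> {a 0..a N}" for t
  proof -
    obtain b where b: "b < N" "t \<in> {a b..a (Suc b)}"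
      using mem_consecutive_interval[OF t N] by blast
    have "{a b..a (Suc b)} \<subseteq> {0..1}"
      using a_in[of b] a_in[of "Suc b"] b(1) by auto
    then have "\<bar>w t - w (a b)\<bar> \<le> \<epsilon> * s"
      using tracks_oscillation[OF continuous_on_subset[OF cont] a_Suc tr[OF b(1)] b(2)] by blast
    moreover have "0 \<le> zigzag r b * s / r"
      using zigzag_nonneg[OF \<open>0 < r\<close>, of b] \<open>0 < s\<close> by simp
    ultimately show ?thesis
      using grid[of b] drift[OF t] b(1) by linarith
  qed
  \<comment> \<open>Peak \<open>i \<ge> 1\<close> ends leg \<open>2 * i - 1\<close>; the valley at
    node \<open>2 * i * r\<close> ends the following leg and so precedes every later peak.\<close>
  define p where "p i = a (Suc (2 * (i - 1)) * r)" for i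
  have idx: "Suc (2 * (i - 1)) * r \<le> 2 * i * r" "2 * i * r \<le> N" if "i \<in> {1..n}" for i
    using that unfolding N_def by (intro mult_le_mono1; force)+
  have "p i \<in> {a 0..a N} \<and> \<bar>bridge w (p i) - bridge w (a 0) - s\<bar> \<le> 3 * \<epsilon> * s" if "i \<in> {1..n}" for i
  proof -
    have le: "Suc (2 * (i - 1)) * r \<le> N"
      using idx[OF that] by (rule order_trans)
    have "zigzag r (Suc (2 * (i - 1)) * r) * s / r = s"
      unfolding zigzag_odd[OF \<open>0 < r\<close>] using \<open>0 < r\<close> by simp
    then show ?thesis
      using node[OF le] a_mono[OF le] a_mono[of 0] by (simp add: p_def del: mult_Suc)
  qed
  moreover have "\<exists>t\<in>{p i..p j}. bridge w t \<le> bridge w (a 0) + 3 * \<epsilon> * s"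
    if "i \<in> {1..n}" "j \<in> {1..n}" "i < j" for i j
  proof
    have "2 * i \<le> Suc (2 * (j - 1))"
      using that by simp
    then have "2 * i * r \<le> Suc (2 * (j - 1)) * r"
      by (rule mult_le_mono1)
    then show "a (2 * i * r) \<in> {p i..p j}"
      using idx(1)[OF that(1)] unfolding p_def by (auto intro!: a_mono)
    show "bridge w (a (2 * i * r)) \<le> bridge w (a 0) + 3 * \<epsilon> * s"
      using node[OF idx(2)[OF that(1)]] by (simp add: zigzag_even[OF \<open>0 < r\<close>])
  qed
  ultimately have "comb (bridge w) (a 0) (a N) s (3 * \<epsilon>) n"
    using low a_mono[of 0 N] unfolding comb_def by blast
  then show ?thesis
    unfolding a0 aN s_def .
qed

section \<open>The minimum of the bridge and the cyclic shift\<close>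

lemma arg_min_on_bridge:
  assumes cont: "continuous_on {0..1} w"
  shows "arg_min_on (bridge w) {0..1} \<in> {0..1}"
    and "t \<in> {0..1} \<Longrightarrow> bridge w (arg_min_on (bridge w) {0..1}) \<le> bridge w t"
proof -
  have "continuous_on {0..1} (bridge w)"
    unfolding bridge_def by (intro continuous_intros cont)
  \<comment> \<open>\<open>arg_min_on\<close> is a choice operator, so a minimiser has to be
    exhibited first; compactness provides one.\<close>
  then obtain x where "x \<in> {0..1}" "\<forall>y\<in>{0..1}. bridge w x \<le> bridge w y"
    using continuous_attains_inf[of "{0..1::real}" "bridge w"] by auto
  then have "is_arg_min (bridge w) (\<lambda>x. x \<in> {0..1}) x"
    by (auto simp: is_arg_min_linorder)
  then have "is_arg_min (bridge w) (\<lambda>x. x \<in> {0..1}) (arg_min_on (bridge w) {0..1})"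
    unfolding arg_min_on_def arg_min_def by (rule someI)
  then show "arg_min_on (bridge w) {0..1} \<in> {0..1}"
    and "t \<in> {0..1} \<Longrightarrow> bridge w (arg_min_on (bridge w) {0..1}) \<le> bridge w t"
    by (auto simp: is_arg_min_linorder)
qed

text \<open>Supplies the lower bound on \<open>{0..1}\<close> from which the metric space axioms of
  the tree follow.\<close>

lemma shift_at_min_bridge_nonneg:
  assumes cont: "continuous_on {0..1} w" and t: "t \<in> {0..1}"
  shows "0 \<le> shift_at_min (bridge w) t"
proof -
  let ?m = "arg_min_on (bridge w) {0..1}"
  show ?thesis
    using arg_min_on_bridge(1)[OF cont] arg_min_on_bridge(2)[OF cont, of "t + ?m"]
      arg_min_on_bridge(2)[OF cont, of "t - 1 + ?m"] t
    by (auto simp: shift_at_min_def Let_def)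
qed

text \<open>An interval on one side of the minimum time \<open>m\<close> is moved as a whole, by
  \<open>- m\<close> if it lies to the right of \<open>m\<close> and by \<open>1 - m\<close> if it
  lies to the left.\<close>

lemma comb_shift_at_min:
  assumes cont: "continuous_on {0..1} w" and "w 0 = 0"
    and comb: "comb (bridge w) u v s \<kappa> n" and "0 \<le> u" "v \<le> 1"
    and m: "v \<le> arg_min_on (bridge w) {0..1} \<or> arg_min_on (bridge w) {0..1} \<le> u"
  shows "\<exists>u' v'. 0 \<le> u' \<and> v' \<le> 1 \<and> comb (shift_at_min (bridge w)) u' v' s \<kappa> n"
proof -
  define m where "m = arg_min_on (bridge w) {0..1}"
  have m_in: "m \<in> {0..1}"
    unfolding m_def by (rule arg_min_on_bridge(1)[OF cont])
  have ends: "bridge w 1 = bridge w 0"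
    using \<open>w 0 = 0\<close> by (simp add: bridge_def)
  consider "m \<le> u" | "v \<le> m"
    using m by (auto simp: m_def)
  then show ?thesis
  proof cases
    case 1
    have "comb (shift_at_min (bridge w)) (u + - m) (v + - m) s \<kappa> n"
      using 1 \<open>v \<le> 1\<close>
      by (intro comb_translate[OF comb, where y = "bridge w m"]) (auto simp: shift_at_min_def Let_def m_def)
    then show ?thesis
      using 1 \<open>v \<le> 1\<close> m_in by (intro exI[of _ "u + - m"] exI[of _ "v + - m"]) auto
  next
    case 2
    have "shift_at_min (bridge w) (t + (1 - m)) = bridge w t - bridge w m" if "t \<in> {u..v}" for t
    \<comment> \<open>At \<open>t = 0\<close> the shifted time \<open>1 - m\<close> falls into the
      first branch of the shift, which reads the path at 1; the bridge has the same value at both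
      ends.\<close>
    proof (cases "t = 0")
      case True
      then show ?thesis using ends by (simp add: shift_at_min_def Let_def flip: m_def)
    next
      case False
      then show ?thesis
        using that \<open>0 \<le> u\<close> by (auto simp: shift_at_min_def Let_def simp flip: m_def)
    qed
    then have "comb (shift_at_min (bridge w)) (u + (1 - m)) (v + (1 - m)) s \<kappa> n"
      by (rule comb_translate[OF comb])
    then show ?thesis
      using 2 \<open>0 \<le> u\<close> m_in by (intro exI[of _ "u + (1 - m)"] exI[of _ "v + (1 - m)"]) auto
  qed
qed

text \<open>The minimum of \<open>f\<close> between two points of the comb is at least
  \<open>f u - c\<close> with \<open>c = s / 32\<close>; between two tips a valley bounds it above
  by \<open>f u + c\<close>. So tips are about \<open>s\<close> from the centre and about
  \<open>2 * s\<close> from each other. The pair of close points serves to tell stars at different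
  scales apart.\<close>

lemma approx_star_if_comb:
  assumes bdd: "bdd_below (f ` {0..1})" and comb: "comb f u v s (1/32) n"
    and "0 \<le> u" "v \<le> 1" "0 < s"
  shows "\<exists>S. Metric_space.is_approx_star (ctree f) (ctree_dist f) (11/5) (3/10) n S \<and>
    (0 < n \<longrightarrow> (\<exists>x\<in>S. \<exists>y\<in>S. 0 < ctree_dist f x y \<and> ctree_dist f x y \<le> 2 * s))"
proof -
  interpret Metric_space "ctree f" "ctree_dist f"
    by (rule Metric_space_ctree[OF bdd])
  define c where "c = s / 32"
  then have c: "1/32 * s = c"
    by simp
  obtain p where low: "\<And>t. t \<in> {u..v} \<Longrightarrow> f u - c \<le> f t"
    and p: "\<And>i. i \<in> {1..n} \<Longrightarrow> p i \<in> {u..v} \<and> \<bar>f (p i) - f u - s\<bar> \<le> c"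
    and valley: "\<And>i j. i \<in> {1..n} \<Longrightarrow> j \<in> {1..n} \<Longrightarrow> i < j \<Longrightarrow> \<exists>t\<in>{p i..p j}. f t \<le> f u + c"
    using comb unfolding comb_def c by blast
  have uv: "u \<in> {0..1}" "u \<le> v"
    using comb assms by (auto simp: comb_def)
  have p01: "p i \<in> {0..1}" if "i \<in> {1..n}" for i
    using p[OF that] assms by auto
  have dist: "0 \<le> x \<Longrightarrow> x \<in> {u..v} \<Longrightarrow> y \<in> {u..v} \<Longrightarrow> x \<le> y \<Longrightarrow> t \<in> {x..y} \<Longrightarrow>
    f x + f y - 2 * f t \<le> ctree_pdist f x y \<and> ctree_pdist f x y \<le> f x + f y - 2 * (f u - c)" for x y t
  proof -
    assume xy: "0 \<le> x" "x \<in> {u..v}" "y \<in> {u..v}" "x \<le> y" "t \<in> {x..y}"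
    have "(INF t\<in>{min x y..max x y}. f t) \<le> f t"
      using xy assms by (intro INF_le_ctree[OF bdd]) auto
    moreover have "f u - c \<le> (INF t\<in>{min x y..max x y}. f t)"
      using xy by (intro cINF_greatest low) auto
    ultimately show ?thesis
      by (simp add: ctree_pdist_def)
  qed
  define X where "X i = ctree_rel f `` {if i = 0 then u else p i}" for i :: nat
  have X0: "ctree_dist f (X 0) (X i) \<in> {s - c..s + 3 * c}" if i: "i \<in> {1..n}" for i
  proof -
    have "ctree_dist f (X 0) (X i) = ctree_pdist f u (p i)"
      using i uv(1) p01[OF i] unfolding X_def by (subst ctree_dist_class[OF bdd]) auto
    then show ?thesis
      using dist[of u "p i" u] p[OF i] uv by auto
  qed
  have Xlt: "ctree_dist f (X i) (X j) \<in> {2 * s - 4 * c..2 * s + 4 * c}"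
    if ij: "i \<in> {1..n}" "j \<in> {1..n}" "i < j" for i j
  proof -
    have "ctree_dist f (X i) (X j) = ctree_pdist f (p i) (p j)"
      using ij p01[OF ij(1)] p01[OF ij(2)] unfolding X_def by (subst ctree_dist_class[OF bdd]) auto
    moreover obtain t where "t \<in> {p i..p j}" "f t \<le> f u + c"
      using valley[OF ij] by blast
    ultimately show ?thesis
      using dist[of "p i" "p j" t] p[OF ij(1)] p[OF ij(2)] p01[OF ij(1)] by auto
  qed
  have Xij: "ctree_dist f (X i) (X j) \<in> {2 * s - 4 * c..2 * s + 4 * c}"
    if "i \<in> {1..n}" "j \<in> {1..n}" "i \<noteq> j" for i j
    using Xlt[of i j] Xlt[of j i] that commute[of "X i" "X j"] by (metis nat_neq_iff)
  have "is_approx_star (11/5) (3/10) n (X ` {0..n})"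
    unfolding is_approx_star_def
  \<comment> \<open>The radius is \<open>s - c\<close>, the lower bound for the distances from the
    centre; the constants 11/5 and 3/10 leave room for the upper bound \<open>s + 3 * c\<close> and
    for the tip distances \<open>2 * s\<close> up to \<open>4 * c\<close>.\<close>
  proof (intro conjI exI[of _ "31/32 * s"] exI[of _ X] ballI impI)
    show "X ` {0..n} \<subseteq> ctree f"
      using uv(1) p01 by (auto simp: X_def ctree_def intro!: quotientI)
    fix i assume i: "i \<in> {1..n}"
    show "31/32 * s \<le> ctree_dist f (X 0) (X i)" "ctree_dist f (X 0) (X i) \<le> (1 + 3/10) * (31/32 * s)"
      using X0[OF i] \<open>0 < s\<close> by (auto simp: c_def)
    fix j assume j: "j \<in> {1..n}" "i \<noteq> j"
    show "(11/5 - 3/10) * (31/32 * s) \<le> ctree_dist f (X i) (X j)"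
      "ctree_dist f (X i) (X j) \<le> 11/5 * (31/32 * s)"
      using Xij[OF i j] \<open>0 < s\<close> by (auto simp: c_def)
  qed (use \<open>0 < s\<close> in auto)
  moreover have "\<exists>x\<in>X ` {0..n}. \<exists>y\<in>X ` {0..n}. 0 < ctree_dist f x y \<and> ctree_dist f x y \<le> 2 * s" if "0 < n"
    using X0[of 1] that \<open>0 < s\<close> by (intro bexI[of _ "X 0"] bexI[of _ "X 1"]) (auto simp: c_def)
  ultimately show ?thesis
    by blast
qed

context Metric_space
begin

text \<open>Every star is finite, so finitely many stars have finitely many distances, and the
  positive ones are bounded away from 0.\<close>

lemma infinite_approx_stars_if_small:
  assumes small: "\<And>\<delta>. 0 < \<delta> \<Longrightarrow> \<exists>S\<in>approx_stars n. \<exists>x\<in>S. \<exists>y\<in>S. 0 < d x y \<and> d x y < \<delta>"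
  shows "infinite (approx_stars n)"
proof
  assume fin: "finite (approx_stars n)"
  have "finite S" if "S \<in> approx_stars n" for S
    using that by (auto simp: approx_stars_def is_approx_star_def)
  then have "finite (\<Union>(approx_stars n))"
    using fin by blast
  then have "finite (case_prod d ` (\<Union>(approx_stars n) \<times> \<Union>(approx_stars n)))" (is "finite ?D")
    by blast
  \<comment> \<open>The default 1 keeps the minimum meaningful when no distance is positive.\<close>
  define \<delta> where "\<delta> = Min (insert 1 {r \<in> ?D. 0 < r})"
  have "finite {r \<in> ?D. 0 < r}"
    using \<open>finite ?D\<close> by simp
  then have "0 < \<delta>" and \<delta>: "\<And>r. r \<in> ?D \<Longrightarrow> 0 < r \<Longrightarrow> \<delta> \<le> r"
    by (auto simp: \<delta>_def)
  obtain S x y where "S \<in> approx_stars n" "x \<in> S" "y \<in> S" "0 < d x y" "d x y < \<delta>"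
    using small[OF \<open>0 < \<delta>\<close>] by blast
  moreover from this have "d x y \<in> ?D"
    by force
  ultimately show False
    using \<delta> by fastforce
qed

lemma is_approx_star_0: "is_approx_star (11/5) (3/10) 0 {x}" if "x \<in> M"
  using that unfolding is_approx_star_def by (auto intro!: exI[of _ 1] exI[of _ "\<lambda>_. x"])

text \<open>A 0-star is a single point and has no positive distances, so the criterion by small
  distances cannot apply. Instead, infinitely many stars force infinitely many points.\<close>

lemma infinite_approx_stars_0:
  assumes "infinite (approx_stars n)"
  shows "infinite (approx_stars 0)"
proof -
  have "approx_stars n \<subseteq> Pow M"
    by (auto simp: approx_stars_def is_approx_star_def)
  then have "infinite M"
    using assms finite_subset finite_Pow_iff by blast
  moreover have "(\<lambda>x. {x}) ` M \<subseteq> approx_stars 0"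
    using is_approx_star_0 by (auto simp: approx_stars_def)
  moreover have "inj_on (\<lambda>x. {x}) M"
    by (simp add: inj_on_def)
  ultimately show ?thesis
    using finite_imageD finite_subset by blast
qed

end

section \<open>Stars of the shifted bridge at arbitrarily small scales\<close>

lemma scale_tendsto_0: "scale \<longlonglongrightarrow> 0"
proof -
  have "(\<lambda>k. 1 / 2 ^ k :: real) \<longlonglongrightarrow> 0"
    by (rule LIMSEQ_divide_realpow_zero) simp
  then have "(\<lambda>k. sqrt (1 / 2 ^ Suc k)) \<longlonglongrightarrow> sqrt 0"
    by (intro tendsto_real_sqrt LIMSEQ_Suc)
  then show ?thesis
    by (simp add: scale_def[abs_def])
qed

text \<open>For large \<open>k\<close> the drift is negligible, the star is smaller than
  \<open>\<delta>\<close>, and the \<open>k\<close>-th interval avoids the minimum time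
  \<open>m\<close>: it lies to the right of \<open>m\<close> if \<open>m < 1\<close> and to the left
  if \<open>m = 1\<close>. The value 1/96 is a third of the 1/32 tolerated by the star.\<close>

lemma small_approx_star_if_infinite_zigzags:
  fixes w :: "real \<Rightarrow> real"
  defines "f \<equiv> shift_at_min (bridge w)"
  assumes cont: "continuous_on {0..1} w" and "w 0 = 0" and "0 < r" "0 < n"
    and inf: "infinite {k. zigzags (2 * n * r) r (1/96) k w}" and "0 < \<delta>"
  shows "\<exists>S. Metric_space.is_approx_star (ctree f) (ctree_dist f) (11/5) (3/10) n S \<and>
    (\<exists>x\<in>S. \<exists>y\<in>S. 0 < ctree_dist f x y \<and> ctree_dist f x y < \<delta>)"
proof -
  define m where "m = arg_min_on (bridge w) {0..1}"
  have m: "m \<in> {0..1}"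
    unfolding m_def by (rule arg_min_on_bridge(1)[OF cont])
  have "(\<lambda>k. scale k * \<bar>w 1\<bar>) \<longlonglongrightarrow> 0 * \<bar>w 1\<bar>"
    by (intro tendsto_mult scale_tendsto_0 tendsto_const)
  then have ev1: "\<forall>\<^sub>F k in sequentially. scale k * \<bar>w 1\<bar> < 1/96"
    by (rule order_tendstoD) simp
  have ev2: "\<forall>\<^sub>F k in sequentially. scale k < \<delta> / 2"
    using scale_tendsto_0 by (rule order_tendstoD) (use \<open>0 < \<delta>\<close> in simp)
  have ev3: "\<forall>\<^sub>F k in sequentially. m = 1 \<or> m < 1 - 1 / 2 ^ k"
  proof (cases "m = 1")
    case False
    have "(\<lambda>k. 1 - 1 / 2 ^ k :: real) \<longlonglongrightarrow> 1 - 0"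
      by (intro tendsto_diff tendsto_const LIMSEQ_divide_realpow_zero) simp
    then have "\<forall>\<^sub>F k in sequentially. m < 1 - 1 / 2 ^ k"
      by (rule order_tendstoD) (use m False in auto)
    then show ?thesis
      by (rule eventually_mono) simp
  qed simp
  obtain k0 where k0: "\<And>k. k0 \<le> k \<Longrightarrow>
      scale k * \<bar>w 1\<bar> < 1/96 \<and> scale k < \<delta> / 2 \<and> (m = 1 \<or> m < 1 - 1 / 2 ^ k)"
    using eventually_conj[OF ev1 eventually_conj[OF ev2 ev3]] unfolding eventually_sequentially by blast
  obtain k where "k0 \<le> k" and zz: "zigzags (2 * n * r) r (1/96) k w"
    using inf unfolding infinite_nat_iff_unbounded_le by blast
  have "comb (bridge w) (1 - 1 / 2 ^ k) (1 - 1 / 2 ^ Suc k) (scale k) (1/32) n"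
    using comb_bridge_if_zigzags[OF cont _ \<open>0 < r\<close> \<open>0 < n\<close> zz] k0[OF \<open>k0 \<le> k\<close>] by simp
  moreover have "1 - 1 / 2 ^ Suc k \<le> m \<or> m \<le> 1 - 1 / 2 ^ k"
    using k0[OF \<open>k0 \<le> k\<close>] by auto
  ultimately obtain u v where uv: "0 \<le> u" "v \<le> 1" "comb f u v (scale k) (1/32) n"
    using comb_shift_at_min[OF cont \<open>w 0 = 0\<close>, of "1 - 1 / 2 ^ k" "1 - 1 / 2 ^ Suc k" "scale k" "1/32" n]
    unfolding f_def m_def by auto
  have "bdd_below (f ` {0..1})"
    using shift_at_min_bridge_nonneg[OF cont] unfolding f_def by (intro bdd_belowI[of _ 0]) auto
  from approx_star_if_comb[OF this uv(3,1,2) scale_pos] show ?thesis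
    using k0[OF \<open>k0 \<le> k\<close>] \<open>0 < n\<close> by fastforce
qed

lemma stars_if_infinite_zigzags:
  fixes w :: "real \<Rightarrow> real"
  defines "f \<equiv> shift_at_min (bridge w)"
  assumes cont: "continuous_on {0..1} w" and "w 0 = 0"
    and inf: "\<And>n. \<exists>r>0. infinite {k. zigzags (2 * Suc n * r) r (1/96) k w}"
  shows "infinite (Metric_space.approx_stars (ctree f) (ctree_dist f) n)"
    and "Metric_space.starry (ctree f) (ctree_dist f)"
proof -
  interpret Metric_space "ctree f" "ctree_dist f"
    using shift_at_min_bridge_nonneg[OF cont] unfolding f_def
    by (intro Metric_space_ctree bdd_belowI[of _ 0]) auto
  have small: "\<exists>S. is_approx_star (11/5) (3/10) n S \<and>
    (\<exists>x\<in>S. \<exists>y\<in>S. 0 < ctree_dist f x y \<and> ctree_dist f x y < \<delta>)" if "0 < \<delta>" "0 < n" for \<delta> n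
  proof -
    obtain r where "0 < r" "infinite {k. zigzags (2 * n * r) r (1/96) k w}"
      using inf[of "n - 1"] \<open>0 < n\<close> by auto
    then show ?thesis
      unfolding f_def using that small_approx_star_if_infinite_zigzags[OF cont \<open>w 0 = 0\<close>] by blast
  qed
  have pos: "infinite (approx_stars n)" if "0 < n" for n
  proof (rule infinite_approx_stars_if_small)
    fix \<delta> :: real assume "0 < \<delta>"
    from small[OF this that]
    show "\<exists>S\<in>approx_stars n. \<exists>x\<in>S. \<exists>y\<in>S. 0 < ctree_dist f x y \<and> ctree_dist f x y < \<delta>"
      unfolding approx_stars_def by blast
  qed
  then show "infinite (approx_stars n)"
    using infinite_approx_stars_0[of 1] by (cases "n = 0") auto
  have "contains_approx_star (11/5) (3/10) n" for n
  proof (cases "n = 0")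
    case True
    obtain x where "x \<in> ctree f"
      using small[of 1 1] by (auto simp: is_approx_star_def)
    then show ?thesis
      using is_approx_star_0 True unfolding contains_approx_star_def by blast
  next
    case False
    then show ?thesis
      using small[of 1 n] unfolding contains_approx_star_def by auto
  qed
  \<comment> \<open>The same constants serve every \<open>n\<close>, and 3/10 is below (11/5 - 1) /
    2 = 3/5.\<close>
  then have "\<exists>A\<^sub>n\<ge>11/5. contains_approx_star A\<^sub>n (3/10) n" for n
    by blast
  then show starry
    unfolding starry_def by - (rule exI[of _ "11/5"], rule exI[of _ "3/10"], simp)
qed

theorem theorem3p5:
  fixes M :: "'a measure" and W :: "real \<Rightarrow> 'a \<Rightarrow> real"
  assumes "wiener_process M W"
  shows "(AE \<omega> in M. \<forall>n :: nat. infinite (Metric_space.approx_stars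
            (ctree (brownian_excursion W \<omega>)) (ctree_dist (brownian_excursion W \<omega>)) n))
       \<and> (AE \<omega> in M. Metric_space.starry
            (ctree (brownian_excursion W \<omega>)) (ctree_dist (brownian_excursion W \<omega>)))"
proof -
  interpret wiener_process M W by fact
  have "AE \<omega> in M. \<exists>r>0. infinite {k. zigzags (2 * Suc n * r) r (1/96) k (\<lambda>t. W t \<omega>)}" for n
  proof -
    obtain r where "0 < r" "AE \<omega> in M. infinite {k. zigzags (2 * Suc n * r) r (1/96) k (\<lambda>t. W t \<omega>)}"
      using AE_infinite_zigzags[of "Suc n" "1/96"] by auto
    then show ?thesis
      by (auto elim!: eventually_mono)
  qed
  \<comment> \<open>The number of blocks per leg may vary with \<open>n\<close>; countably many
    exceptional null sets are united.\<close>
  then have "AE \<omega> in M. \<forall>n. \<exists>r>0. infinite {k. zigzags (2 * Suc n * r) r (1/96) k (\<lambda>t. W t \<omega>)}"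
    by (subst AE_all_countable) (rule allI)
  then have "AE \<omega> in M. (\<forall>n. infinite (Metric_space.approx_stars
            (ctree (brownian_excursion W \<omega>)) (ctree_dist (brownian_excursion W \<omega>)) n)) \<and>
      Metric_space.starry (ctree (brownian_excursion W \<omega>)) (ctree_dist (brownian_excursion W \<omega>))"
    using start continuous_paths
  proof eventually_elim
    case (elim \<omega>)
    then show ?case
      unfolding brownian_excursion_def using stars_if_infinite_zigzags[of "\<lambda>t. W t \<omega>"] by auto
  qed
  then show ?thesis
    by (simp only: AE_conj_iff)
qed

end
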